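(* The identity map $\iota:\mathcal S_1\otimes_{\min}\mathcal S_1\to\mathcal S_1\otimes_{\max}\mathcal S_1$ is positive but not $2$-positive. In particular $\mathcal S_1\otimes_{\rm c}\mathcal S_1=\mathcal S_1\otimes_{\min}\mathcal S_1\neq\mathcal S_1\otimes_{\max}\mathcal S_1$.
   Context: $\mathcal S_1=\mathrm{span}\{1,z,\bar z\}\subseteq C(\mathbb T)\cong C^*(\mathbb F_1)$, $z$ the identity function on the unit circle. $\otimes_{\min}$ is the spatial tensor product (so $\mathcal S_1\otimes_{\min}\mathcal S_1\subseteq C(\mathbb T^2)$ with the induced matrix order); $\otimes_{\max}$ is the maximal operator system tensor product (matrix cones the Archimedeanization of $\{A^*(P\otimes Q)A: P\in M_k(\mathcal S)_+,Q\in M_m(\mathcal T)_+, A \text{ scalar}\}$); $\otimes_{\rm c}$ is the commuting tensor product (positivity tested by all $\phi\cdot\psi$ with $\phi,\psi$ completely positive with commuting ranges, $(\phi\cdot\psi)(x\otimes y)=\phi(x)\psi(y)$). *)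

theory Defs
  imports "HOL-Analysis.Analysis" "HOL-Library.Complex_Order"
begin

text \<open>
Concrete model.  S1 = span{z^a : a in {-1,0,1}} inside C(T).
A complex n x n matrix is a function nat => nat => complex (entries r,s < n).
An element of M_n(S1) is given by its coefficient matrices P a (a in {-1,0,1}),
i.e. P = sum_a P a * z^a.  An element of M_n(S1 (x) S1) is given by coefficient
matrices X a b, i.e. X = sum_{a,b} X a b * z^a (x) w^b.
\<close>

type_synonym cmat = "nat \<Rightarrow> nat \<Rightarrow> complex"

definition Dexp :: "int set" where
  "Dexp = {-1, 0, 1}"

definition psd :: "nat \<Rightarrow> cmat \<Rightarrow> bool" where
  "psd n A \<longleftrightarrow> (\<forall>v :: nat \<Rightarrow> complex.
      0 \<le> (\<Sum>i<n. \<Sum>j<n. cnj (v i) * A i j * v j))"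

definition S1_pos :: "nat \<Rightarrow> (int \<Rightarrow> cmat) \<Rightarrow> bool" where
  "S1_pos k P \<longleftrightarrow> (\<forall>z::complex. cmod z = 1 \<longrightarrow>
      psd k (\<lambda>i j. \<Sum>a\<in>Dexp. P a i j * z powi a))"

text \<open>Minimal (spatial) tensor product: induced order from C(T^2).\<close>
definition min_pos :: "nat \<Rightarrow> (int \<Rightarrow> int \<Rightarrow> cmat) \<Rightarrow> bool" where
  "min_pos n X \<longleftrightarrow> (\<forall>z w::complex. cmod z = 1 \<longrightarrow> cmod w = 1 \<longrightarrow>
      psd n (\<lambda>r s. \<Sum>a\<in>Dexp. \<Sum>b\<in>Dexp. X a b r s * z powi a * w powi b))"

text \<open>Maximal tensor product: the set D_n of all A^* (P (x) Q) A with P in M_k(S1)_+,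
  Q in M_m(S1)_+, A a scalar (km) x n matrix; row index (i,p) of P (x) Q is i*m+p.\<close>
definition max_D :: "nat \<Rightarrow> (int \<Rightarrow> int \<Rightarrow> cmat) \<Rightarrow> bool" where
  "max_D n X \<longleftrightarrow> (\<exists>k m P Q (A::cmat). S1_pos k P \<and> S1_pos m Q \<and>
      (\<forall>a\<in>Dexp. \<forall>b\<in>Dexp. \<forall>r<n. \<forall>s<n.
         X a b r s = (\<Sum>i<k. \<Sum>j<k. \<Sum>p<m. \<Sum>q<m.
             cnj (A (i*m+p) r) * (P a i j * Q b p q) * A (j*m+q) s)))"

text \<open>Archimedeanization with respect to the unit 1 (x) 1: X is positive iff
  X + eps * (I_n (x) 1 (x) 1) lies in D_n for every eps > 0.\<close>
definition max_pos :: "nat \<Rightarrow> (int \<Rightarrow> int \<Rightarrow> cmat) \<Rightarrow> bool" where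
  "max_pos n X \<longleftrightarrow> (\<forall>\<epsilon>::real. \<epsilon> > 0 \<longrightarrow>
      max_D n (\<lambda>a b r s. X a b r s +
         (if a = 0 \<and> b = 0 \<and> r = s then complex_of_real \<epsilon> else 0)))"

definition l2 :: "('i \<Rightarrow> complex) set" where
  "l2 = {f. (\<lambda>i. (cmod (f i))\<^sup>2) summable_on UNIV}"

definition l2inner :: "('i \<Rightarrow> complex) \<Rightarrow> ('i \<Rightarrow> complex) \<Rightarrow> complex" where
  "l2inner f g = (\<Sum>\<^sub>\<infinity>i. f i * cnj (g i))"

definition l2norm :: "('i \<Rightarrow> complex) \<Rightarrow> real" where
  "l2norm f = sqrt (\<Sum>\<^sub>\<infinity>i. (cmod (f i))\<^sup>2)"

definition bounded_op :: "(('i \<Rightarrow> complex) \<Rightarrow> ('i \<Rightarrow> complex)) \<Rightarrow> bool" where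
  "bounded_op T \<longleftrightarrow> (\<forall>f\<in>l2. T f \<in> l2) \<and>
     (\<forall>f\<in>l2. \<forall>g\<in>l2. T (\<lambda>i. f i + g i) = (\<lambda>i. T f i + T g i)) \<and>
     (\<forall>f\<in>l2. \<forall>c. T (\<lambda>i. c * f i) = (\<lambda>i. c * T f i)) \<and>
     (\<exists>C. \<forall>f\<in>l2. l2norm (T f) \<le> C * l2norm f)"

definition op_psd :: "nat \<Rightarrow> (nat \<Rightarrow> nat \<Rightarrow> ('i \<Rightarrow> complex) \<Rightarrow> ('i \<Rightarrow> complex)) \<Rightarrow> bool" where
  "op_psd n T \<longleftrightarrow> (\<forall>h :: nat \<Rightarrow> 'i \<Rightarrow> complex. (\<forall>j<n. h j \<in> l2) \<longrightarrow>
      0 \<le> (\<Sum>r<n. \<Sum>s<n. l2inner (T r s (h s)) (h r)))"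

text \<open>A linear map phi : S1 -> B(H) is given by Phi a = phi(z^a).  Complete positivity.\<close>
definition cp_S1 :: "(int \<Rightarrow> ('i \<Rightarrow> complex) \<Rightarrow> ('i \<Rightarrow> complex)) \<Rightarrow> bool" where
  "cp_S1 \<Phi> \<longleftrightarrow> (\<forall>a\<in>Dexp. bounded_op (\<Phi> a)) \<and>
     (\<forall>k P. S1_pos k P \<longrightarrow>
        op_psd k (\<lambda>i j f t. \<Sum>a\<in>Dexp. P a i j * \<Phi> a f t))"

definition commuting_ranges ::
  "(int \<Rightarrow> ('i \<Rightarrow> complex) \<Rightarrow> ('i \<Rightarrow> complex)) \<Rightarrow>
   (int \<Rightarrow> ('i \<Rightarrow> complex) \<Rightarrow> ('i \<Rightarrow> complex)) \<Rightarrow> bool" where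
  "commuting_ranges \<Phi> \<Psi> \<longleftrightarrow>
     (\<forall>a\<in>Dexp. \<forall>b\<in>Dexp. \<forall>f\<in>l2. \<Phi> a (\<Psi> b f) = \<Psi> b (\<Phi> a f))"

text \<open>Commuting tensor product, tested with cp maps into B(l2('i)):
  (phi . psi)(z^a (x) w^b) = phi(z^a) psi(w^b).\<close>
definition comm_pos :: "'i itself \<Rightarrow> nat \<Rightarrow> (int \<Rightarrow> int \<Rightarrow> cmat) \<Rightarrow> bool" where
  "comm_pos _ n X \<longleftrightarrow> (\<forall>\<Phi> \<Psi> :: int \<Rightarrow> ('i \<Rightarrow> complex) \<Rightarrow> ('i \<Rightarrow> complex).
      cp_S1 \<Phi> \<longrightarrow> cp_S1 \<Psi> \<longrightarrow> commuting_ranges \<Phi> \<Psi> \<longrightarrow>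
      op_psd n (\<lambda>r s f t. \<Sum>a\<in>Dexp. \<Sum>b\<in>Dexp. X a b r s * \<Phi> a (\<Psi> b f) t))"

end

theory Submission
  imports Defs
begin

text \<open>
  \<^bold>\<open>Positive.\<close> A function \<open>x\<^sub>0 + x\<^sub>1 w + x\<^sub>-\<^sub>1 w\<^sup>-\<^sup>1\<close> with \<open>x\<^sub>b\<close> in \<open>S\<^sub>1\<close> is nonnegative for all unimodular
  \<open>w\<close> iff the matrix \<open>P = [[x\<^sub>0/2, x\<^sub>1], [x\<^sub>-\<^sub>1, x\<^sub>0/2]]\<close> is positive over \<open>S\<^sub>1\<close>, and the function is the
  sum of the entrywise tensor products of \<open>P\<close> and the positive matrix \<open>[[1, w], [w\<^sup>-\<^sup>1, 1]]\<close>.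

  \<^bold>\<open>Commuting equals minimal.\<close> A completely positive map on \<open>S\<^sub>1\<close> is a pair \<open>A, B\<close> of operators (the
  images of \<open>1\<close> and \<open>z\<close>) for which \<open>[[A, B], [B\<^sup>*, A]]\<close> is positive. If \<open>R\<close> is a polynomial in \<open>A\<close>
  approximating its inverse, then \<open>W = R B\<close> is a contraction for the form of \<open>A\<close>, so with
  \<open>V = \<zeta>\<^sup>-\<^sup>1 W\<close> and \<open>G\<^sub>j = 1 + V + \<dots> + V\<^sup>j\<^sup>-\<^sup>1\<close> the Fejer sum of the moments \<open>A V\<^sup>k\<close>, \<open>V\<^sup>*\<^sup>k A\<close> equals
  \<open>G\<^sub>N\<^sup>* A G\<^sub>N + \<Sum> G\<^sub>j\<^sup>* (A - V\<^sup>* A V) G\<^sub>j\<close> and is positive. Averaging over roots of unity \<open>\<zeta>\<close> represents the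
  map, up to a vanishing error, by point evaluations with positive operator weights in the algebra
  generated by \<open>A, B, B\<^sup>*\<close>. For two maps with commuting ranges the weights commute, so their products
  are positive, and minimal positivity of \<open>X\<close> gives positivity of its image.

  \<^bold>\<open>Not 2-positive.\<close> The Shifts unextendible product basis of three qubits consists of four
  orthogonal product vectors such that no product vector is orthogonal to all of them. Read as a
  function on the torus, the sum of the four rank one projections is positive definite at every
  point, so it stays minimally positive after subtracting a small multiple of the unit. The
  functional given by the complementary projection is nonnegative on the maximal cone, annihilates
  the sum, and is strictly positive at the unit.
\<close>

section \<open>The Hilbert space of square-summable functions\<close>

lemma l2_iff_summable: "f \<in> l2 \<longleftrightarrow> (\<lambda>i. (cmod (f i))\<^sup>2) summable_on UNIV"
  by (simp add: l2_def)

lemma l2_add: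
  assumes "f \<in> l2" "g \<in> l2"
  shows "(\<lambda>i. f i + g i) \<in> l2"
  unfolding l2_iff_summable
proof (rule summable_on_comparison_test)
  show "(\<lambda>i. 2 * (cmod (f i))\<^sup>2 + 2 * (cmod (g i))\<^sup>2) summable_on UNIV"
    using assms by (intro summable_on_add summable_on_cmult_right) (auto simp: l2_iff_summable)
  fix i
  have "(cmod (f i + g i))\<^sup>2 \<le> (cmod (f i) + cmod (g i))\<^sup>2"
    by (intro power_mono norm_triangle_ineq) auto
  also have "\<dots> \<le> 2 * (cmod (f i))\<^sup>2 + 2 * (cmod (g i))\<^sup>2"
    using zero_le_power2[of "cmod (f i) - cmod (g i)"]
    by (simp add: power2_eq_square algebra_simps)
  finally show "(cmod (f i + g i))\<^sup>2 \<le> 2 * (cmod (f i))\<^sup>2 + 2 * (cmod (g i))\<^sup>2" .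
qed auto

lemma l2_scale: "f \<in> l2 \<Longrightarrow> (\<lambda>i. c * f i) \<in> l2"
  by (simp add: l2_iff_summable norm_mult power_mult_distrib summable_on_cmult_right)

lemma l2_zero: "(\<lambda>i. 0) \<in> l2"
  by (simp add: l2_iff_summable)

lemma l2_uminus: "f \<in> l2 \<Longrightarrow> (\<lambda>i. - f i) \<in> l2"
  by (simp add: l2_iff_summable)

lemma l2_diff: "f \<in> l2 \<Longrightarrow> g \<in> l2 \<Longrightarrow> (\<lambda>i. f i - g i) \<in> l2"
  using l2_add[of f "\<lambda>i. - g i"] by (simp add: l2_uminus)

lemma l2_finite_support:
  assumes "finite I"
  shows "(\<lambda>i. if i \<in> I then f i else 0) \<in> l2"
proof -
  have "(\<lambda>i. (cmod (if i \<in> I then f i else 0))\<^sup>2) summable_on I"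
    using assms by simp
  then show ?thesis
    unfolding l2_iff_summable by (rule summable_on_cong_neutral[THEN iffD1, rotated -1]) auto
qed

lemma l2_product_summable:
  assumes "f \<in> l2" "g \<in> l2"
  shows "(\<lambda>i. f i * cnj (g i)) summable_on UNIV"
proof -
  have "(\<lambda>i. norm (f i * f i)) summable_on UNIV"
    and "(\<lambda>i. norm (cnj (g i) * cnj (g i))) summable_on UNIV"
    using assms by (auto simp: l2_iff_summable norm_mult power2_eq_square)
  then have "(\<lambda>i. norm (f i * cnj (g i))) summable_on UNIV"
    by (rule abs_summable_product)
  then show ?thesis by (rule abs_summable_summable)
qed

typedef 'i ell2 = "l2 :: ('i \<Rightarrow> complex) set"
  morphisms coord Abs_ell2
  using l2_zero by blast

setup_lifting type_definition_ell2

lift_definition cscale :: "complex \<Rightarrow> 'i ell2 \<Rightarrow> 'i ell2" (infixr "*\<^sub>C" 75) is "\<lambda>c f i. c * f i"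
  by (rule l2_scale)

lift_definition cinner :: "'i ell2 \<Rightarrow> 'i ell2 \<Rightarrow> complex" ("\<langle>_, _\<rangle>") is l2inner .

instantiation ell2 :: (type) real_vector
begin

lift_definition zero_ell2 :: "'a ell2" is "\<lambda>i. 0" by (rule l2_zero)
lift_definition plus_ell2 :: "'a ell2 \<Rightarrow> 'a ell2 \<Rightarrow> 'a ell2" is "\<lambda>f g i. f i + g i" by (rule l2_add)
lift_definition minus_ell2 :: "'a ell2 \<Rightarrow> 'a ell2 \<Rightarrow> 'a ell2" is "\<lambda>f g i. f i - g i" by (rule l2_diff)
lift_definition uminus_ell2 :: "'a ell2 \<Rightarrow> 'a ell2" is "\<lambda>f i. - f i" by (rule l2_uminus)
lift_definition scaleR_ell2 :: "real \<Rightarrow> 'a ell2 \<Rightarrow> 'a ell2" is "\<lambda>r f i. complex_of_real r * f i"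
  by (rule l2_scale)

instance
  by standard (transfer; simp add: fun_eq_iff algebra_simps)+

end

lemma cscale_of_real: "complex_of_real r *\<^sub>C x = r *\<^sub>R x"
  by transfer simp

lemma cscale_one [simp]: "1 *\<^sub>C x = x"
  by transfer simp

lemma cscale_cscale [simp]: "c *\<^sub>C d *\<^sub>C x = (c * d) *\<^sub>C x"
  by transfer (simp add: mult.assoc)

lemma coord_sum: "coord (\<Sum>k\<in>K. f k) i = (\<Sum>k\<in>K. coord (f k) i)"
  by (induction K rule: infinite_finite_induct) (auto simp: zero_ell2.rep_eq plus_ell2.rep_eq)

lemma cinner_commute: "\<langle>y, x\<rangle> = cnj \<langle>x, y\<rangle>"
  by transfer (simp add: l2inner_def mult.commute flip: infsum_cnj)

lemma cinner_add_left: "\<langle>x + y, z\<rangle> = \<langle>x, z\<rangle> + \<langle>y, z\<rangle>"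
  by transfer (simp add: l2inner_def distrib_right infsum_add l2_product_summable)

lemma cinner_cscale_left [simp]: "\<langle>c *\<^sub>C x, y\<rangle> = c * \<langle>x, y\<rangle>"
  by transfer (simp add: l2inner_def mult.assoc infsum_cmult_right')

lemma cinner_cscale_right [simp]: "\<langle>x, c *\<^sub>C y\<rangle> = cnj c * \<langle>x, y\<rangle>"
  by (subst (1 2) cinner_commute) simp

lemma cinner_self: "\<langle>x, x\<rangle> = complex_of_real (\<Sum>\<^sub>\<infinity>i. (cmod (coord x i))\<^sup>2)"
proof -
  have "\<langle>x, x\<rangle> = (\<Sum>\<^sub>\<infinity>i. complex_of_real ((cmod (coord x i))\<^sup>2))"
    unfolding cinner.rep_eq l2inner_def by (simp only: complex_norm_square)
  also have "\<dots> = complex_of_real (\<Sum>\<^sub>\<infinity>i. (cmod (coord x i))\<^sup>2)"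
    using coord[of x] by (intro infsumI has_sum_of_real has_sum_infsum) (simp add: l2_iff_summable)
  finally show ?thesis .
qed

lemma cinner_self_eq_0_iff: "\<langle>x, x\<rangle> = 0 \<longleftrightarrow> x = 0"
proof
  have summable: "(\<lambda>i. (cmod (coord x i))\<^sup>2) summable_on UNIV"
    using coord[of x] by (simp add: l2_iff_summable)
  assume "\<langle>x, x\<rangle> = 0"
  then have "(\<Sum>\<^sub>\<infinity>i. (cmod (coord x i))\<^sup>2) = 0" by (simp add: cinner_self)
  then have "(cmod (coord x i))\<^sup>2 = 0" for i
    by (intro nonneg_infsum_le_0D[OF _ summable]) auto
  then show "x = 0"
    by (simp add: zero_ell2.rep_eq fun_eq_iff flip: coord_inject)
qed (simp add: cinner_self zero_ell2.rep_eq)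

instantiation ell2 :: (type) real_inner
begin

definition inner_ell2 :: "'a ell2 \<Rightarrow> 'a ell2 \<Rightarrow> real" where
  "inner_ell2 x y = Re \<langle>x, y\<rangle>"

definition norm_ell2 :: "'a ell2 \<Rightarrow> real" where
  "norm_ell2 x = sqrt (inner x x)"

definition dist_ell2 :: "'a ell2 \<Rightarrow> 'a ell2 \<Rightarrow> real" where
  "dist_ell2 x y = norm (x - y)"

definition sgn_ell2 :: "'a ell2 \<Rightarrow> 'a ell2" where
  "sgn_ell2 x = inverse (norm x) *\<^sub>R x"

definition uniformity_ell2 :: "('a ell2 \<times> 'a ell2) filter" where
  "uniformity_ell2 = (INF e\<in>{0 <..}. principal {(x, y). dist x y < e})"

definition open_ell2 :: "'a ell2 set \<Rightarrow> bool" where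
  "open_ell2 U \<longleftrightarrow> (\<forall>x\<in>U. \<forall>\<^sub>F (x', y) in uniformity. x' = x \<longrightarrow> y \<in> U)"

instance
proof
  fix x y z :: "'a ell2" and r :: real and U :: "'a ell2 set"
  show "inner x y = inner y x"
    unfolding inner_ell2_def by (subst cinner_commute) simp
  show "inner (x + y) z = inner x z + inner y z"
    by (simp add: inner_ell2_def cinner_add_left)
  show "inner (r *\<^sub>R x) y = r * inner x y"
    by (simp add: inner_ell2_def flip: cscale_of_real)
  show "0 \<le> inner x x"
    by (simp add: inner_ell2_def cinner_self infsum_nonneg)
  show "inner x x = 0 \<longleftrightarrow> x = 0"
    by (metis Re_complex_of_real cinner_self cinner_self_eq_0_iff inner_ell2_def of_real_eq_0_iff)
qed (fact norm_ell2_def dist_ell2_def sgn_ell2_def uniformity_ell2_def open_ell2_def)+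

end

lemma cinner_self_norm: "\<langle>x, x\<rangle> = complex_of_real ((norm x)\<^sup>2)"
  using cinner_self[of x] by (simp add: power2_norm_eq_inner inner_ell2_def)

lemma norm_eq_l2norm: "norm x = l2norm (coord x)"
  by (simp add: norm_ell2_def inner_ell2_def cinner_self l2norm_def)

lemma norm_cscale: "norm (c *\<^sub>C x) = cmod c * norm x"
proof -
  have "complex_of_real ((norm (c *\<^sub>C x))\<^sup>2) = complex_of_real ((cmod c * norm x)\<^sup>2)"
    unfolding cinner_self_norm[symmetric] power_mult_distrib of_real_mult complex_norm_square
    by simp
  then show ?thesis
    by (simp only: of_real_eq_iff power2_eq_iff_nonneg norm_ge_zero mult_nonneg_nonneg)
qed

interpretation cscale: bounded_bilinear cscale
proof
  fix c d :: complex and x y :: "'a ell2" and r :: real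
  show "(c + d) *\<^sub>C x = c *\<^sub>C x + d *\<^sub>C x" "c *\<^sub>C (x + y) = c *\<^sub>C x + c *\<^sub>C y"
    by (transfer; simp add: algebra_simps)+
  show "(r *\<^sub>R c) *\<^sub>C x = r *\<^sub>R c *\<^sub>C x" "c *\<^sub>C r *\<^sub>R x = r *\<^sub>R c *\<^sub>C x"
    by (simp_all add: scaleR_conv_of_real mult.commute flip: cscale_of_real)
  show "\<exists>K. \<forall>c (x :: 'a ell2). norm (c *\<^sub>C x) \<le> norm c * norm x * K"
    by (metis mult.right_neutral norm_cscale order_refl)
qed

lemma norm_cinner_le: "cmod \<langle>x, y\<rangle> \<le> norm x * norm y"
proof -
  define c where "c = cnj (sgn \<langle>x, y\<rangle>)"
  have norm_c_le: "cmod c \<le> 1" by (simp add: c_def norm_sgn)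
  have "c * \<langle>x, y\<rangle> = (\<langle>x, y\<rangle> * cnj \<langle>x, y\<rangle>) / complex_of_real (cmod \<langle>x, y\<rangle>)"
    by (simp add: c_def sgn_eq)
  also have "\<dots> = complex_of_real (cmod \<langle>x, y\<rangle>)"
    by (simp add: power2_eq_square flip: complex_norm_square)
  finally have "cmod \<langle>x, y\<rangle> = inner (c *\<^sub>C x) y"
    by (simp add: inner_ell2_def)
  also have "\<dots> \<le> norm (c *\<^sub>C x) * norm y"
    by (rule norm_cauchy_schwarz)
  also have "\<dots> \<le> norm x * norm y"
    using norm_c_le by (simp add: norm_cscale mult_left_le_one_le mult_right_mono)
  finally show ?thesis .
qed

interpretation cinner: bounded_bilinear cinner
proof
  fix x x' y y' :: "'a ell2" and r :: real
  show "\<langle>x + x', y\<rangle> = \<langle>x, y\<rangle> + \<langle>x', y\<rangle>" by (rule cinner_add_left)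
  show "\<langle>x, y + y'\<rangle> = \<langle>x, y\<rangle> + \<langle>x, y'\<rangle>"
    by (subst (1 2 3) cinner_commute) (simp add: cinner_add_left)
  show "\<langle>r *\<^sub>R x, y\<rangle> = r *\<^sub>R \<langle>x, y\<rangle>" "\<langle>x, r *\<^sub>R y\<rangle> = r *\<^sub>R \<langle>x, y\<rangle>"
    by (simp_all add: scaleR_conv_of_real flip: cscale_of_real)
  show "\<exists>K. \<forall>x y :: 'a ell2. cmod \<langle>x, y\<rangle> \<le> norm x * norm y * K"
    by (metis mult.right_neutral norm_cinner_le)
qed

lemma cinner_ext:
  assumes "\<And>z. \<langle>x, z\<rangle> = \<langle>y, z\<rangle>"
  shows "x = y"
proof -
  have "\<langle>x - y, x - y\<rangle> = 0" by (simp add: cinner.diff_left assms)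
  then show ?thesis by (simp add: cinner_self_eq_0_iff)
qed

lemma ex_nonzero_ell2: "\<exists>x :: 'i ell2. x \<noteq> 0"
proof -
  let ?e = "\<lambda>i :: 'i. if i \<in> {undefined} then 1 else 0"
  have "?e \<in> l2" by (rule l2_finite_support) simp
  then have "coord (Abs_ell2 ?e) undefined = 1" by (simp add: Abs_ell2_inverse)
  then show ?thesis by (metis zero_ell2.rep_eq zero_neq_one)
qed

section \<open>Ordered rings with involution\<close>

class star_ring = ring_1 +
  fixes star :: "'a \<Rightarrow> 'a"
  assumes star_star [simp]: "star (star a) = a"
    and star_add [simp]: "star (a + b) = star a + star b"
    and star_mult [simp]: "star (a * b) = star b * star a"
begin

lemma star_zero [simp]: "star 0 = 0"
  using star_add[of 0 0] by (simp only: add_0_right add_cancel_right_right)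

lemma star_one [simp]: "star 1 = 1"
  using star_mult[of "star 1" 1] by simp

lemma star_uminus [simp]: "star (- a) = - star a"
  using star_add[of a "- a"] by (simp add: eq_neg_iff_add_eq_0 add.commute)

lemma star_diff [simp]: "star (a - b) = star a - star b"
  using star_add[of a "- b"] by simp

lemma star_sum [simp]: "star (\<Sum>i\<in>I. f i) = (\<Sum>i\<in>I. star (f i))"
  by (induction I rule: infinite_finite_induct) auto

lemma star_power [simp]: "star (a ^ n) = star a ^ n"
  by (induction n) (simp_all add: power_commutes)

lemma star_of_nat [simp]: "star (of_nat n) = of_nat n"
  by (induction n) simp_all

end

class ordered_star_ring = star_ring + ordered_ab_group_add +
  assumes one_nonneg: "0 \<le> 1"
    and conj_nonneg: "0 \<le> a \<Longrightarrow> 0 \<le> star b * a * b"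
    and star_eq_of_nonneg: "0 \<le> a \<Longrightarrow> star a = a"
begin

lemma conj_mono: "a \<le> b \<Longrightarrow> star c * a * c \<le> star c * b * c"
  using conj_nonneg[of "b - a" c] by (simp add: algebra_simps)

lemma of_nat_mult_nonneg: "0 \<le> a \<Longrightarrow> 0 \<le> of_nat n * a"
  by (induction n) (simp_all add: distrib_right add_nonneg_nonneg)

lemma of_nat_mult_mono: "a \<le> b \<Longrightarrow> of_nat n * a \<le> of_nat n * b"
  using of_nat_mult_nonneg[of "b - a" n] by (simp add: right_diff_distrib)

end

definition commute :: "'a::ring_1 \<Rightarrow> 'a \<Rightarrow> bool" where
  "commute a b \<longleftrightarrow> a * b = b * a"

lemma commute_sym: "commute a b \<Longrightarrow> commute b a"
  by (simp add: commute_def)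

lemma commute_one: "commute a 1"
  by (simp add: commute_def)

lemma commute_diff: "commute a b \<Longrightarrow> commute a c \<Longrightarrow> commute a (b - c)"
  by (simp add: commute_def algebra_simps)

lemma commute_mult: "commute a b \<Longrightarrow> commute a c \<Longrightarrow> commute a (b * c)"
  unfolding commute_def by (metis mult.assoc)

lemma commute_power: "commute a b \<Longrightarrow> commute a (b ^ n)"
  by (induction n) (auto intro: commute_one commute_mult)

lemma commute_sum: "(\<And>i. i \<in> I \<Longrightarrow> commute a (f i)) \<Longrightarrow> commute a (\<Sum>i\<in>I. f i)"
  by (simp add: commute_def sum_distrib_left sum_distrib_right)

lemma commute_star_star: "commute a b \<Longrightarrow> commute (star a) (star b)"
  unfolding commute_def by (metis star_mult)

lemma power_mult_nonneg:
  fixes a b :: "'a::ordered_star_ring"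
  assumes "star a = a" "commute a b" "0 \<le> b" "0 \<le> a * b"
  shows "0 \<le> a ^ k * b"
proof -
  have comm: "a ^ j * b = b * a ^ j" for j
    using assms(2) unfolding commute_def by (rule power_commuting_commutes)
  show ?thesis
  proof (cases "even k")
    case True
    then obtain j where "k = j + j" by (metis evenE mult_2)
    then have "a ^ k * b = star (a ^ j) * b * a ^ j"
      by (simp only: power_add star_power assms(1) mult.assoc) (simp only: comm mult.assoc)
    then show ?thesis using assms by (simp only: conj_nonneg)
  next
    case False
    then obtain j where "k = j + Suc j" by (metis oddE mult_2 add_Suc_right Suc_eq_plus1)
    then have "a ^ k * b = star (a ^ j) * (a * b) * a ^ j"
      by (simp only: power_add power_Suc star_power assms(1) mult.assoc)
         (simp only: comm mult.assoc)
    then show ?thesis using assms by (simp only: conj_nonneg)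
  qed
qed

locale unit_interval =
  fixes a :: "'a::ordered_star_ring"
  assumes nonneg: "0 \<le> a" and le_1: "a \<le> 1"
begin

lemma star_eq [simp]: "star a = a"
  using nonneg by (rule star_eq_of_nonneg)

lemma mult_compl_nonneg: "0 \<le> a * (1 - a)"
proof -
  have "a * (1 - a) = star (1 - a) * a * (1 - a) + star a * (1 - a) * a"
    by (simp add: algebra_simps)
  then show ?thesis
    using nonneg le_1 by (simp only: add_nonneg_nonneg conj_nonneg diff_ge_0_iff_ge)
qed

lemma power_nonneg: "0 \<le> a ^ k"
  using power_mult_nonneg[of a 1 k] nonneg by (simp add: commute_one one_nonneg)

lemma power_mult_compl_nonneg: "0 \<le> a ^ k * (1 - a)"
  using mult_compl_nonneg le_1
  by (intro power_mult_nonneg) (auto simp: commute_def algebra_simps)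

lemma power_mult_compl_antimono: "decseq (\<lambda>k. a ^ k * (1 - a))"
proof (rule decseq_SucI)
  fix k
  have "0 \<le> a ^ k * (star (1 - a) * 1 * (1 - a))"
  proof (rule power_mult_nonneg)
    have "a * (star (1 - a) * 1 * (1 - a)) = star (1 - a) * a * (1 - a)"
      by (simp add: algebra_simps)
    then show "0 \<le> a * (star (1 - a) * 1 * (1 - a))"
      using nonneg by (simp only: conj_nonneg)
  qed (simp_all only: conj_nonneg one_nonneg, auto simp: commute_def algebra_simps)
  also have "\<dots> = a ^ k * (1 - a) - a ^ Suc k * (1 - a)"
    by (simp add: algebra_simps power_Suc2 del: power_Suc)
  finally show "a ^ Suc k * (1 - a) \<le> a ^ k * (1 - a)" by simp
qed

lemma power_mult_compl_le: "of_nat (Suc m) * (a ^ m * (1 - a)) \<le> 1"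
proof -
  have "of_nat (Suc m) * (a ^ m * (1 - a)) = (\<Sum>k<Suc m. a ^ m * (1 - a))"
    by (simp only: sum_constant card_lessThan)
  also have "\<dots> \<le> (\<Sum>k<Suc m. a ^ k * (1 - a))"
    using power_mult_compl_antimono by (intro sum_mono) (auto elim: decseqD)
  also have "\<dots> = (\<Sum>k<Suc m. a ^ k - a ^ Suc k)"
    by (simp only: right_diff_distrib mult_1_right power_Suc2)
  also have "\<dots> = 1 - a ^ Suc m"
    by (simp only: sum_lessThan_telescope' power_0)
  also have "\<dots> \<le> 1"
    using power_nonneg by (simp only: diff_le_eq le_add_same_cancel1)
  finally show ?thesis .
qed

lemma unit_interval_diff_square: "unit_interval (a - a * a)"
proof
  show "0 \<le> a - a * a"
    using mult_compl_nonneg by (simp add: right_diff_distrib)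
  have "0 \<le> star a * 1 * a"
    by (intro conj_nonneg one_nonneg)
  then have "a - a * a \<le> a" by simp
  then show "a - a * a \<le> 1" using le_1 by (rule order_trans)
qed

end

text \<open>The remainder of the expansion of \<open>a\<close> into a series of squares due to F. Riesz, which stands
  in for the square root of \<open>a\<close>.\<close>

primrec riesz_remainder :: "'a::ring \<Rightarrow> nat \<Rightarrow> 'a" where
  "riesz_remainder a 0 = a"
| "riesz_remainder a (Suc k) = riesz_remainder a k - riesz_remainder a k * riesz_remainder a k"

lemma riesz_expansion:
  "a = (\<Sum>k<N. riesz_remainder a k * riesz_remainder a k) + riesz_remainder a N"
  by (induction N) (auto simp: algebra_simps)

lemma commute_riesz_remainder: "commute b a \<Longrightarrow> commute b (riesz_remainder a k)"
  by (induction k) (auto intro: commute_diff commute_mult)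

lemma (in unit_interval) unit_interval_riesz_remainder: "unit_interval (riesz_remainder a k)"
  by (induction k) (auto intro: unit_interval.unit_interval_diff_square unit_interval_axioms)

section \<open>Toeplitz pairs\<close>

text \<open>The last condition says that the matrix with rows \<open>A, B\<close> and \<open>B\<^sup>*, A\<close> is positive.\<close>

locale toeplitz_pair =
  fixes A B :: "'a::ordered_star_ring"
  assumes A_le_1: "A \<le> 1"
    and toeplitz_nonneg:
      "0 \<le> star S * A * S + star T * A * T + star S * B * T + star T * star B * S"
begin

lemma A_nonneg: "0 \<le> A"
  using toeplitz_nonneg[of 1 0] by simp

sublocale A: unit_interval A
  using A_nonneg A_le_1 by unfold_locales

sublocale compl: unit_interval "1 - A"
  using A_nonneg A_le_1 by unfold_locales auto

definition approx_inverse :: "nat \<Rightarrow> 'a" where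
  "approx_inverse K = (\<Sum>k<K. (1 - A) ^ k)"

definition remainder :: "nat \<Rightarrow> 'a" where
  "remainder K = (1 - A) ^ K"

definition quotient :: "nat \<Rightarrow> 'a" where
  "quotient K = approx_inverse K * B"

lemma star_approx_inverse [simp]: "star (approx_inverse K) = approx_inverse K"
  by (simp add: approx_inverse_def)

lemma star_remainder [simp]: "star (remainder K) = remainder K"
  by (simp add: remainder_def)

lemma A_remainder_commute: "A * remainder K = remainder K * A"
proof -
  have "commute A (remainder K)"
    unfolding remainder_def
    by (intro commute_power commute_diff commute_one) (simp add: commute_def)
  then show ?thesis by (simp add: commute_def)
qed

lemma approx_inverse_A: "approx_inverse K * A = 1 - remainder K"
proof -
  have "approx_inverse K * A = (\<Sum>k<K. (1 - A) ^ k - (1 - A) ^ Suc k)"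
    unfolding approx_inverse_def sum_distrib_right
    by (intro sum.cong refl) (simp add: power_Suc2 right_diff_distrib del: power_Suc)
  also have "\<dots> = 1 - remainder K"
    by (simp only: sum_lessThan_telescope' power_0 remainder_def)
  finally show ?thesis .
qed

lemma A_approx_inverse: "A * approx_inverse K = 1 - remainder K"
  using arg_cong[OF approx_inverse_A[of K], of star] by simp

lemma A_quotient: "A * quotient K = B - remainder K * B"
  by (simp add: quotient_def A_approx_inverse left_diff_distrib flip: mult.assoc)

lemma star_quotient_A: "star (quotient K) * A = star B - star B * remainder K"
  using arg_cong[OF A_quotient[of K], of star] by simp

lemma square_compl_remainder_A_le: "(1 - remainder K) * (1 - remainder K) * A \<le> A"
proof -
  have "(1 - A) ^ (K + K) * (1 - (1 - A)) \<le> (1 - A) ^ K * (1 - (1 - A))"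
    using compl.power_mult_compl_antimono by (rule decseqD) simp
  then have "0 \<le> remainder K * A - remainder K * remainder K * A"
    by (simp add: remainder_def power_add mult.assoc)
  moreover have "0 \<le> remainder K * A"
    using compl.power_mult_compl_nonneg[of K] by (simp add: remainder_def)
  ultimately have "0 \<le> (remainder K * A - remainder K * remainder K * A) + remainder K * A"
    by (rule add_nonneg_nonneg)
  also have "\<dots> = A - (1 - remainder K) * (1 - remainder K) * A"
    by (simp add: algebra_simps)
  finally show ?thesis by simp
qed

lemma quotient_contraction: "star (quotient K) * A * quotient K \<le> A"
proof -
  let ?W = "quotient K" and ?R = "approx_inverse K"
  let ?S = "- (?R * A * ?W)"
  have square: "A * ?R * A * ?R * A \<le> A"
    using square_compl_remainder_A_le[of K]
    by (simp add: A_approx_inverse approx_inverse_A mult.assoc A_remainder_commute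
        left_diff_distrib right_diff_distrib)
  have "0 \<le> star ?S * A * ?S + star 1 * A * 1 + star ?S * B * 1 + star 1 * star B * ?S"
    by (rule toeplitz_nonneg)
  also have "\<dots> = (star ?W * (A * ?R * A * ?R * A) * ?W + A) - (star ?W * A * ?W + star ?W * A * ?W)"
    by (simp add: quotient_def mult.assoc)
  also have "\<dots> \<le> (star ?W * A * ?W + A) - (star ?W * A * ?W + star ?W * A * ?W)"
    by (intro diff_right_mono add_right_mono conj_mono square)
  finally show ?thesis by (simp add: algebra_simps)
qed

lemma remainder_A_remainder_le: "of_nat (Suc (2 * K)) * (remainder K * A * remainder K) \<le> 1"
proof -
  have "remainder K * A * remainder K = (1 - A) ^ (2 * K) * (1 - (1 - A))"
    by (simp add: mult.assoc A_remainder_commute)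
       (simp add: remainder_def power_add mult_2 mult.assoc)
  then show ?thesis using compl.power_mult_compl_le[of "2 * K"] by simp
qed

lemma star_B_remainder_small:
  "of_nat (Suc (2 * K)) * (star (star B * remainder K) * (star B * remainder K)) \<le> 1"
proof -
  let ?E = "remainder K" and ?S = "- (star B * remainder K)"
  have "star ?S * A * ?S \<le> star ?S * 1 * ?S"
    by (intro conj_mono A_le_1)
  then have "0 \<le> star ?E * A * ?E + star ?S * 1 * ?S + star ?E * B * ?S + star ?S * star B * ?E"
    using toeplitz_nonneg[of ?E ?S]
    by (meson add_left_mono add_right_mono order_trans)
  also have "\<dots> = ?E * A * ?E - star (star B * ?E) * (star B * ?E)"
    by (simp add: mult.assoc)
  finally have "star (star B * ?E) * (star B * ?E) \<le> ?E * A * ?E"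
    by simp
  from of_nat_mult_mono[OF this] remainder_A_remainder_le show ?thesis
    by (rule order_trans)
qed

lemma remainder_B_small:
  "of_nat (Suc (2 * K)) * (star (remainder K * B) * (remainder K * B)) \<le> 1"
proof -
  let ?E = "remainder K" and ?n = "of_nat (Suc (2 * K)) :: 'a"
  let ?Y = "star (?E * B) * (?E * B)" and ?S = "- (of_nat (Suc (2 * K)) * (?E * ?E * B))"
  have comm: "a * ?n = ?n * a" "a * (?n * b) = ?n * (a * b)" for a b
    by (metis mult_of_nat_commute, metis mult_of_nat_commute mult.assoc)
  note central = comm[of A] comm[of B] comm[of "star B"] comm[of ?E]
  have "star (?E * B) * (?n * (?E * A * ?E)) * (?E * B) \<le> star (?E * B) * 1 * (?E * B)"
    by (intro conj_mono remainder_A_remainder_le)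
  from of_nat_mult_mono[OF this, of "Suc (2 * K)"]
  have quadratic: "star ?S * A * ?S \<le> ?n * ?Y"
    by (simp add: mult.assoc central del: of_nat_Suc)
  have "0 \<le> star ?S * A * ?S + star 1 * A * 1 + star ?S * B * 1 + star 1 * star B * ?S"
    by (rule toeplitz_nonneg)
  also have "\<dots> = star ?S * A * ?S + A - (?n * ?Y + ?n * ?Y)"
    by (simp add: mult.assoc central del: of_nat_Suc)
  also have "\<dots> \<le> ?n * ?Y + 1 - (?n * ?Y + ?n * ?Y)"
    by (intro diff_right_mono add_mono quadratic A_le_1)
  finally show ?thesis by simp
qed

lemma commute_quotient: "commute S A \<Longrightarrow> commute S B \<Longrightarrow> commute S (quotient K)"
  unfolding quotient_def approx_inverse_def
  by (intro commute_mult commute_sum commute_power commute_diff commute_one)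

lemma commute_star_quotient:
  assumes "commute S A" "commute S (star B)"
  shows "commute S (star (quotient K))"
proof -
  have "commute (star S) (quotient K)"
    using assms[THEN commute_star_star] by (intro commute_quotient) auto
  then show ?thesis using commute_star_star by fastforce
qed

end

section \<open>Fejer sums\<close>

definition moment :: "'a::star_ring \<Rightarrow> 'a \<Rightarrow> int \<Rightarrow> 'a" where
  "moment A V k = (if 0 \<le> k then A * V ^ nat k else star V ^ nat (- k) * A)"

definition geometric_sum :: "'a::ring_1 \<Rightarrow> nat \<Rightarrow> 'a" where
  "geometric_sum V N = (\<Sum>i<N. V ^ i)"

definition fejer_sum :: "'a::star_ring \<Rightarrow> 'a \<Rightarrow> nat \<Rightarrow> 'a" where
  "fejer_sum A V N = (\<Sum>i<N. \<Sum>j<N. moment A V (int j - int i))"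

lemma star_moment:
  assumes "star A = A"
  shows "star (moment A V k) = moment A V (- k)"
  using assms by (simp add: moment_def)

lemma commute_moment:
  "commute a A \<Longrightarrow> commute a V \<Longrightarrow> commute a (star V) \<Longrightarrow> commute a (moment A V k)"
  by (auto simp: moment_def intro: commute_mult commute_power)

lemma commute_fejer_sum:
  "commute a A \<Longrightarrow> commute a V \<Longrightarrow> commute a (star V) \<Longrightarrow> commute a (fejer_sum A V N)"
  unfolding fejer_sum_def by (intro commute_sum commute_moment)

lemma geometric_sum_Suc: "geometric_sum V (Suc N) = 1 + V * geometric_sum V N"
  by (simp add: geometric_sum_def sum.lessThan_Suc_shift sum_distrib_left del: sum.lessThan_Suc)

lemma commute_geometric_sum: "commute a V \<Longrightarrow> commute a (geometric_sum V N)"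
  unfolding geometric_sum_def by (intro commute_sum commute_power)

lemma fejer_sum_Suc:
  "fejer_sum A V (Suc N) = fejer_sum A V N
    + A * (V * geometric_sum V N) + star (V * geometric_sum V N) * A + A"
proof -
  have "(\<Sum>i<N. moment A V (int N - int i)) = (\<Sum>i<N. A * V ^ Suc (N - Suc i))"
    by (intro sum.cong refl) (simp add: moment_def nat_diff_distrib Suc_diff_Suc del: power_Suc)
  then have column: "(\<Sum>i<N. moment A V (int N - int i)) = A * (V * geometric_sum V N)"
    using sum.nat_diff_reindex[of "\<lambda>i. A * V ^ Suc i" N]
    by (simp add: geometric_sum_def sum_distrib_left)
  have "(\<Sum>i<N. moment A V (int i - int N)) = (\<Sum>i<N. star V ^ Suc (N - Suc i) * A)"
    by (intro sum.cong refl) (simp add: moment_def nat_diff_distrib Suc_diff_Suc del: power_Suc)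
  then have row: "(\<Sum>i<N. moment A V (int i - int N)) = star (V * geometric_sum V N) * A"
    using sum.nat_diff_reindex[of "\<lambda>i. star V ^ Suc i * A" N]
    by (simp add: geometric_sum_def sum_distrib_right power_Suc2 del: power_Suc)
  have "fejer_sum A V (Suc N) = fejer_sum A V N + (\<Sum>i<N. moment A V (int N - int i))
      + (\<Sum>i<N. moment A V (int i - int N)) + moment A V 0"
    by (simp add: fejer_sum_def sum.distrib)
  then show ?thesis unfolding column row by (simp add: moment_def)
qed

lemma fejer_sum_eq_sum_conj:
  "fejer_sum A V N = star (geometric_sum V N) * A * geometric_sum V N
    + (\<Sum>j<N. star (geometric_sum V j) * (A - star V * A * V) * geometric_sum V j)"
proof (induction N)
  case (Suc N)
  then show ?case
    unfolding fejer_sum_Suc geometric_sum_Suc sum.lessThan_Suc by (simp add: algebra_simps)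
qed (simp add: fejer_sum_def geometric_sum_def)

lemma fejer_multiplicity:
  fixes x :: "'a::ring_1"
  shows "(\<Sum>i<N. \<Sum>j<N. if int j - int i = a then x else 0) = of_nat (N - nat \<bar>a\<bar>) * x"
proof -
  have "(\<Sum>j<N. if int j - int i = a then x else 0)
      = (if i \<in> {nat (- a)..<N - nat a} then x else 0)" if "i < N" for i
  proof -
    have "(\<Sum>j<N. if int j - int i = a then x else 0)
        = (\<Sum>j<N. if nat (a + int i) = j then if 0 \<le> a + int i then x else 0 else 0)"
      by (intro sum.cong refl) auto
    then show ?thesis using that by auto
  qed
  then have "(\<Sum>i<N. \<Sum>j<N. if int j - int i = a then x else 0)
      = (\<Sum>i<N. if i \<in> {nat (- a)..<N - nat a} then x else 0)"
    by simp
  also have "\<dots> = (\<Sum>i\<in>{nat (- a)..<N - nat a}. x)"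
    by (intro sum.mono_neutral_cong_right) auto
  also have "\<dots> = of_nat (N - nat \<bar>a\<bar>) * x"
    by (auto simp: abs_if)
  finally show ?thesis .
qed

section \<open>Adjointable operators\<close>

lemma additive_of_ex_adjoint:
  assumes "\<forall>y. \<exists>z. \<forall>x. \<langle>T x, y\<rangle> = \<langle>x, z\<rangle>"
  shows "T (u + v) = T u + T v"
proof (rule cinner_ext)
  fix y
  show "\<langle>T (u + v), y\<rangle> = \<langle>T u + T v, y\<rangle>"
    using assms by (metis cinner.add_left)
qed

typedef 'i ell2_op = "{T :: 'i ell2 \<Rightarrow> 'i ell2. \<forall>y. \<exists>z. \<forall>x. \<langle>T x, y\<rangle> = \<langle>x, z\<rangle>}"
  morphisms apply_op Abs_ell2_op
  by (rule exI[of _ id]) auto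

setup_lifting type_definition_ell2_op

notation apply_op (infixr "\<cdot>" 75)

instantiation ell2_op :: (type) ring_1
begin

lift_definition zero_ell2_op :: "'a ell2_op" is "\<lambda>x. 0"
  by (auto intro: exI[of _ 0] simp: cinner.zero_left cinner.zero_right)

lift_definition one_ell2_op :: "'a ell2_op" is "\<lambda>x. x"
  by blast

lift_definition plus_ell2_op :: "'a ell2_op \<Rightarrow> 'a ell2_op \<Rightarrow> 'a ell2_op" is "\<lambda>S T x. S x + T x"
  by (metis cinner.add_left cinner.add_right)

lift_definition uminus_ell2_op :: "'a ell2_op \<Rightarrow> 'a ell2_op" is "\<lambda>T x. - T x"
  by (metis cinner.minus_left cinner.minus_right)

lift_definition minus_ell2_op :: "'a ell2_op \<Rightarrow> 'a ell2_op \<Rightarrow> 'a ell2_op" is "\<lambda>S T x. S x - T x"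
  by (metis cinner.diff_left cinner.diff_right)

lift_definition times_ell2_op :: "'a ell2_op \<Rightarrow> 'a ell2_op \<Rightarrow> 'a ell2_op" is "\<lambda>S T x. S (T x)"
  by metis

instance
proof
  fix a b c :: "'a ell2_op"
  show "a * (b + c) = a * b + a * c"
    by transfer (simp add: additive_of_ex_adjoint)
  show "(0 :: 'a ell2_op) \<noteq> 1"
    by transfer (metis ex_nonzero_ell2)
qed (transfer; simp add: fun_eq_iff algebra_simps)+

end

lemmas apply_op_simps [simp] =
  zero_ell2_op.rep_eq one_ell2_op.rep_eq plus_ell2_op.rep_eq minus_ell2_op.rep_eq
  uminus_ell2_op.rep_eq times_ell2_op.rep_eq

lemma apply_op_sum: "(\<Sum>i\<in>I. f i) \<cdot> x = (\<Sum>i\<in>I. f i \<cdot> x)"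
  by (induction I rule: infinite_finite_induct) auto

lemma ell2_op_eqI:
  assumes "\<And>x y. \<langle>S \<cdot> x, y\<rangle> = \<langle>T \<cdot> x, y\<rangle>"
  shows "S = T"
proof -
  have "S \<cdot> x = T \<cdot> x" for x using assms by (rule cinner_ext)
  then show ?thesis by (metis apply_op_inject ext)
qed

lift_definition adjoint_op :: "'i ell2_op \<Rightarrow> 'i ell2_op" is
  "\<lambda>T y. SOME z. \<forall>x. \<langle>T x, y\<rangle> = \<langle>x, z\<rangle>"
proof -
  fix T :: "'i ell2 \<Rightarrow> 'i ell2" and y
  assume "\<And>y. \<exists>z. \<forall>x. \<langle>T x, y\<rangle> = \<langle>x, z\<rangle>"
  then have "\<langle>T y, x\<rangle> = \<langle>y, SOME z. \<forall>x'. \<langle>T x', x\<rangle> = \<langle>x', z\<rangle>\<rangle>" for x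
    using someI_ex[of "\<lambda>z. \<forall>x'. \<langle>T x', x\<rangle> = \<langle>x', z\<rangle>"] by blast
  then show "\<exists>z. \<forall>x. \<langle>SOME z. \<forall>x'. \<langle>T x', x\<rangle> = \<langle>x', z\<rangle>, y\<rangle> = \<langle>x, z\<rangle>"
    by (metis cinner_commute)
qed

lemma cinner_adjoint_right: "\<langle>x, adjoint_op T \<cdot> y\<rangle> = \<langle>T \<cdot> x, y\<rangle>"
proof transfer
  fix T :: "'a ell2 \<Rightarrow> 'a ell2" and x y
  assume "\<forall>y. \<exists>z. \<forall>x. \<langle>T x, y\<rangle> = \<langle>x, z\<rangle>"
  then show "\<langle>x, SOME z. \<forall>x. \<langle>T x, y\<rangle> = \<langle>x, z\<rangle>\<rangle> = \<langle>T x, y\<rangle>"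
    using someI_ex[of "\<lambda>z. \<forall>x. \<langle>T x, y\<rangle> = \<langle>x, z\<rangle>"] by metis
qed

lemma cinner_adjoint_left: "\<langle>adjoint_op T \<cdot> x, y\<rangle> = \<langle>x, T \<cdot> y\<rangle>"
  by (subst (1 2) cinner_commute) (simp add: cinner_adjoint_right)

text \<open>Polarisation: replacing \<open>v\<close> by \<open>\<i> v\<close> turns the imaginary parts into real parts.\<close>

lemma adjoint_of_real_sum:
  assumes "\<And>c v. S (c *\<^sub>C v) = c *\<^sub>C S v"
    and "\<And>u v. Im (\<langle>S v, u\<rangle> + \<langle>T u, v\<rangle>) = 0"
  shows "\<langle>T x, y\<rangle> = \<langle>x, S y\<rangle>"
proof -
  have "\<langle>T x, y\<rangle> = cnj \<langle>S y, x\<rangle>"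
    using assms(2)[of y x] assms(2)[of "\<i> *\<^sub>C y" x] by (simp add: assms(1) complex_eq_iff)
  then show ?thesis by (simp flip: cinner_commute)
qed

lemma apply_op_add_right: "T \<cdot> (x + y) = T \<cdot> x + T \<cdot> y"
  by (rule cinner_ext) (simp add: cinner.add_left flip: cinner_adjoint_right)

lemma apply_op_cscale: "T \<cdot> c *\<^sub>C x = c *\<^sub>C T \<cdot> x"
  by (rule cinner_ext) (simp flip: cinner_adjoint_right)

lemma adjoint_op_eq_of_real_diagonal:
  assumes "\<And>x. Im \<langle>T \<cdot> x, x\<rangle> = 0"
  shows "adjoint_op T = T"
proof (rule ell2_op_eqI)
  fix x y
  have "\<langle>T \<cdot> x, y\<rangle> = \<langle>x, T \<cdot> y\<rangle>"
  proof (rule adjoint_of_real_sum)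
    fix u v
    show "Im (\<langle>T \<cdot> v, u\<rangle> + \<langle>T \<cdot> u, v\<rangle>) = 0"
      using assms[of "u + v"] assms[of u] assms[of v]
      by (simp add: apply_op_add_right cinner.add_left cinner.add_right)
  qed (rule apply_op_cscale)
  then show "\<langle>adjoint_op T \<cdot> x, y\<rangle> = \<langle>T \<cdot> x, y\<rangle>"
    by (simp add: cinner_adjoint_left)
qed

lemma eq_0_of_zero_diagonal:
  assumes "\<And>x. \<langle>T \<cdot> x, x\<rangle> = 0"
  shows "T = 0"
proof (rule ell2_op_eqI)
  fix x y
  have "adjoint_op T = T"
    by (rule adjoint_op_eq_of_real_diagonal) (simp add: assms)
  then have "\<langle>T \<cdot> T \<cdot> x, x\<rangle> = \<langle>T \<cdot> x, T \<cdot> x\<rangle>"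
    by (metis cinner_adjoint_left)
  moreover have "\<langle>T \<cdot> T \<cdot> x, x\<rangle> + \<langle>T \<cdot> x, T \<cdot> x\<rangle> = 0"
    using assms[of "x + T \<cdot> x"]
    by (simp add: apply_op_add_right cinner.add_left cinner.add_right assms)
  ultimately have "T \<cdot> x = 0"
    by (simp flip: cinner_self_eq_0_iff)
  then show "\<langle>T \<cdot> x, y\<rangle> = \<langle>0 \<cdot> x, y\<rangle>" by simp
qed

instantiation ell2_op :: (type) ordered_star_ring
begin

definition star_ell2_op :: "'a ell2_op \<Rightarrow> 'a ell2_op" where
  "star_ell2_op = adjoint_op"

definition less_eq_ell2_op :: "'a ell2_op \<Rightarrow> 'a ell2_op \<Rightarrow> bool" where
  "S \<le> T \<longleftrightarrow> (\<forall>x. 0 \<le> \<langle>(T - S) \<cdot> x, x\<rangle>)"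

definition less_ell2_op :: "'a ell2_op \<Rightarrow> 'a ell2_op \<Rightarrow> bool" where
  "(S :: 'a ell2_op) < T \<longleftrightarrow> S \<le> T \<and> \<not> T \<le> S"

instance
proof
  fix a b c :: "'a ell2_op"
  show "star (star a) = a"
    unfolding star_ell2_op_def
    by (rule ell2_op_eqI) (simp add: cinner_adjoint_left cinner_adjoint_right)
  show "star (a + b) = star a + star b"
    unfolding star_ell2_op_def
    by (rule ell2_op_eqI) (simp add: cinner_adjoint_left cinner.add_left cinner.add_right)
  show "star (a * b) = star b * star a"
    unfolding star_ell2_op_def
    by (rule ell2_op_eqI) (simp add: cinner_adjoint_left)
  show "a < b \<longleftrightarrow> a \<le> b \<and> \<not> b \<le> a"
    by (rule less_ell2_op_def)
  show "a \<le> a"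
    by (simp add: less_eq_ell2_op_def cinner.zero_left)
  show "0 \<le> (1 :: 'a ell2_op)"
    by (simp add: less_eq_ell2_op_def cinner_self_norm less_eq_complex_def)
  show "0 \<le> star b * a * b" if "0 \<le> a"
    using that by (simp add: less_eq_ell2_op_def star_ell2_op_def cinner_adjoint_left)
  show "c + a \<le> c + b" if "a \<le> b"
    using that by (simp add: less_eq_ell2_op_def)
  show "a \<le> c" if "a \<le> b" "b \<le> c"
    unfolding less_eq_ell2_op_def
  proof
    fix x
    have "0 \<le> \<langle>(b - a) \<cdot> x, x\<rangle> + \<langle>(c - b) \<cdot> x, x\<rangle>"
      using that unfolding less_eq_ell2_op_def by (intro add_nonneg_nonneg) blast+
    then show "0 \<le> \<langle>(c - a) \<cdot> x, x\<rangle>"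
      by (simp add: cinner.diff_left)
  qed
  show "star a = a" if "0 \<le> a"
    using that unfolding star_ell2_op_def
    by (intro adjoint_op_eq_of_real_diagonal) (simp add: less_eq_ell2_op_def less_eq_complex_def)
  show "a = b" if "a \<le> b" "b \<le> a"
  proof -
    have "0 \<le> \<langle>(a - b) \<cdot> x, x\<rangle>" "0 \<le> \<langle>(b - a) \<cdot> x, x\<rangle>" for x
      using that unfolding less_eq_ell2_op_def by blast+
    then have "\<langle>(a - b) \<cdot> x, x\<rangle> = 0" for x
      by (simp add: cinner.diff_left order_antisym_conv)
    then show "a = b" using eq_0_of_zero_diagonal[of "a - b"] by simp
  qed
qed

end

lemma cinner_star_right: "\<langle>x, star T \<cdot> y\<rangle> = \<langle>T \<cdot> x, y\<rangle>"
  by (simp add: star_ell2_op_def cinner_adjoint_right)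

lemma cinner_star_left: "\<langle>star T \<cdot> x, y\<rangle> = \<langle>x, T \<cdot> y\<rangle>"
  by (simp add: star_ell2_op_def cinner_adjoint_left)

lift_definition scalar_op :: "complex \<Rightarrow> 'i ell2_op" is cscale
  by (metis cinner_cscale_left cinner_cscale_right complex_cnj_cnj)

declare scalar_op.rep_eq [simp]

lemma scalar_op_add: "scalar_op (c + d) = scalar_op c + scalar_op d"
  by (rule ell2_op_eqI) (simp add: cscale.add_left)

lemma scalar_op_zero [simp]: "scalar_op 0 = 0"
  by (rule ell2_op_eqI) (simp add: cscale.zero_left)

lemma scalar_op_one [simp]: "scalar_op 1 = 1"
  by (rule ell2_op_eqI) simp

lemma scalar_op_sum: "scalar_op (\<Sum>i\<in>I. c i) = (\<Sum>i\<in>I. scalar_op (c i))"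
  by (induction I rule: infinite_finite_induct) (auto simp: scalar_op_add)

lemma scalar_op_of_nat: "scalar_op (of_nat n) = of_nat n"
  by (induction n) (auto simp: scalar_op_add)

lemma cinner_scalar_op_mult: "\<langle>(scalar_op c * T) \<cdot> x, y\<rangle> = c * \<langle>T \<cdot> x, y\<rangle>"
  by simp

lemma scalar_op_mult: "scalar_op c * scalar_op d = scalar_op (c * d)"
  by (rule ell2_op_eqI) simp

lemma scalar_op_mult_left: "scalar_op c * (scalar_op d * T) = scalar_op (c * d) * T"
  by (simp add: scalar_op_mult flip: mult.assoc)

lemma scalar_op_commute: "T * scalar_op c = scalar_op c * T"
  by (rule ell2_op_eqI) (simp add: apply_op_cscale)

lemma scalar_op_commute_left: "T * (scalar_op c * S) = scalar_op c * (T * S)"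
  by (metis scalar_op_commute mult.assoc)

lemma scalar_op_mult_mult: "scalar_op c * S * (scalar_op d * T) = scalar_op (c * d) * (S * T)"
  by (simp only: mult.assoc scalar_op_commute_left[of S] scalar_op_mult_left)

lemma commute_scalar_op: "commute T (scalar_op c)"
  by (simp add: commute_def scalar_op_commute)

lemma scalar_op_mult_power: "(scalar_op c * T) ^ k = scalar_op (c ^ k) * T ^ k"
  by (induction k) (simp_all add: mult.assoc scalar_op_commute_left[of T] scalar_op_mult_left)

lemma star_scalar_op [simp]: "star (scalar_op c) = scalar_op (cnj c)"
  by (rule ell2_op_eqI) (simp add: cinner_star_left)

lemma tendsto_0_of_scaled_square_le_one:
  assumes "\<And>K. of_nat (Suc (2 * K)) * (star (D K) * D K) \<le> 1"
  shows "(\<lambda>K. D K \<cdot> x) \<longlonglongrightarrow> 0"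
proof -
  have bound: "(norm (D K \<cdot> x))\<^sup>2 \<le> (norm x)\<^sup>2 * inverse (real (Suc K))" for K
  proof -
    have "0 \<le> \<langle>(1 - scalar_op (of_nat (Suc (2 * K))) * (star (D K) * D K)) \<cdot> x, x\<rangle>"
      using assms[of K] by (simp only: less_eq_ell2_op_def scalar_op_of_nat)
    then have "0 \<le> complex_of_real ((norm x)\<^sup>2 - real (Suc (2 * K)) * (norm (D K \<cdot> x))\<^sup>2)"
      by (simp add: cinner.diff_left cinner_star_left cinner_self_norm)
    then have "real (Suc (2 * K)) * (norm (D K \<cdot> x))\<^sup>2 \<le> (norm x)\<^sup>2"
      by (simp add: less_eq_complex_def)
    moreover have "real (Suc K) * (norm (D K \<cdot> x))\<^sup>2 \<le> real (Suc (2 * K)) * (norm (D K \<cdot> x))\<^sup>2"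
      by (intro mult_right_mono) auto
    ultimately have "real (Suc K) * (norm (D K \<cdot> x))\<^sup>2 \<le> (norm x)\<^sup>2" by linarith
    then show ?thesis by (simp add: field_simps)
  qed
  have "(\<lambda>K. (norm x)\<^sup>2 * inverse (real (Suc K))) \<longlonglongrightarrow> 0"
    by (intro tendsto_mult_right_zero LIMSEQ_inverse_real_of_nat)
  then have "(\<lambda>K. (norm (D K \<cdot> x))\<^sup>2) \<longlonglongrightarrow> 0"
    by (rule Lim_null_comparison[rotated]) (use bound in \<open>simp del: of_nat_Suc\<close>)
  then have "(\<lambda>K. sqrt ((norm (D K \<cdot> x))\<^sup>2)) \<longlonglongrightarrow> sqrt 0"
    by (rule tendsto_real_sqrt)
  then show ?thesis by (simp add: tendsto_norm_zero_iff)
qed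

lemma riesz_remainder_tendsto_0:
  fixes T :: "'i ell2_op"
  assumes "unit_interval T"
  shows "(\<lambda>k. riesz_remainder T k \<cdot> x) \<longlonglongrightarrow> 0"
proof -
  let ?R = "riesz_remainder T"
  have unit: "unit_interval (?R k)" for k
    using assms by (rule unit_interval.unit_interval_riesz_remainder)
  have square: "\<langle>(?R k * ?R k) \<cdot> x, x\<rangle> = (norm (?R k \<cdot> x))\<^sup>2" for k
    using cinner_star_left[of "?R k"] unit_interval.star_eq[OF unit, of k]
    by (simp add: cinner_self_norm)
  have "(\<Sum>k<N. (norm (?R k \<cdot> x))\<^sup>2) \<le> Re \<langle>T \<cdot> x, x\<rangle>" for N
  proof -
    have "\<langle>T \<cdot> x, x\<rangle> = (\<Sum>k<N. \<langle>(?R k * ?R k) \<cdot> x, x\<rangle>) + \<langle>?R N \<cdot> x, x\<rangle>"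
      by (subst riesz_expansion[of T N])
         (simp add: apply_op_sum cinner.sum_left cinner.add_left)
    moreover have "0 \<le> \<langle>?R N \<cdot> x, x\<rangle>"
      using unit_interval.nonneg[OF unit, of N] by (simp add: less_eq_ell2_op_def)
    ultimately show ?thesis
      unfolding square by (simp add: less_eq_complex_def)
  qed
  then have "summable (\<lambda>k. (norm (?R k \<cdot> x))\<^sup>2)"
    by (intro summableI_nonneg_bounded) auto
  then have "(\<lambda>k. sqrt ((norm (?R k \<cdot> x))\<^sup>2)) \<longlonglongrightarrow> sqrt 0"
    by (intro tendsto_real_sqrt summable_LIMSEQ_zero)
  then show ?thesis by (simp add: tendsto_norm_zero_iff)
qed

section \<open>Positive tensor products\<close>

definition psd_on :: "'i set \<Rightarrow> ('i \<Rightarrow> 'i \<Rightarrow> complex) \<Rightarrow> bool" where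
  "psd_on I K \<longleftrightarrow> (\<forall>v. 0 \<le> (\<Sum>i\<in>I. \<Sum>j\<in>I. cnj (v i) * K i j * v j))"

lemma psd_iff_psd_on: "psd n F \<longleftrightarrow> psd_on {..<n} F"
  by (simp add: psd_def psd_on_def)

lemma complex_mult_cnj_nonneg: "0 \<le> cnj u * u" for u :: complex
  by (simp add: less_eq_complex_def)

lemma psd_on_gram:
  assumes "\<And>i j. i \<in> I \<Longrightarrow> j \<in> I \<Longrightarrow> K i j = (\<Sum>l\<in>L. cnj (G l i) * G l j)"
  shows "psd_on I K"
  unfolding psd_on_def
proof
  fix v
  let ?u = "\<lambda>l. \<Sum>j\<in>I. G l j * v j"
  have "(\<Sum>i\<in>I. \<Sum>j\<in>I. cnj (v i) * K i j * v j)
      = (\<Sum>i\<in>I. \<Sum>j\<in>I. \<Sum>l\<in>L. cnj (G l i * v i) * (G l j * v j))"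
    by (intro sum.cong refl) (simp add: assms sum_distrib_left sum_distrib_right mult_ac)
  also have "\<dots> = (\<Sum>i\<in>I. \<Sum>l\<in>L. \<Sum>j\<in>I. cnj (G l i * v i) * (G l j * v j))"
    by (intro sum.cong refl sum.swap)
  also have "\<dots> = (\<Sum>l\<in>L. \<Sum>i\<in>I. \<Sum>j\<in>I. cnj (G l i * v i) * (G l j * v j))"
    by (rule sum.swap)
  also have "\<dots> = (\<Sum>l\<in>L. cnj (?u l) * ?u l)"
    by (simp only: sum_product cnj_sum)
  also have "\<dots> \<ge> 0"
    by (intro sum_nonneg complex_mult_cnj_nonneg)
  finally show "0 \<le> (\<Sum>i\<in>I. \<Sum>j\<in>I. cnj (v i) * K i j * v j)" .
qed

definition tensor_nonneg :: "nat \<Rightarrow> cmat \<Rightarrow> 'i ell2_op \<Rightarrow> bool" where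
  "tensor_nonneg n F Q \<longleftrightarrow> (\<forall>h. 0 \<le> (\<Sum>r<n. \<Sum>s<n. F r s * \<langle>Q \<cdot> h s, h r\<rangle>))"

lemma complex_nonneg_limit:
  fixes f :: "nat \<Rightarrow> complex"
  assumes "f \<longlonglongrightarrow> l" "\<And>n. 0 \<le> f n"
  shows "0 \<le> l"
proof -
  have "Re l \<ge> 0"
    using tendsto_Re[OF assms(1)] assms(2)
    by (auto intro: LIMSEQ_le_const simp: less_eq_complex_def)
  moreover have "Im l = 0"
    using tendsto_Im[OF assms(1)] assms(2) by (simp add: less_eq_complex_def LIMSEQ_const_iff)
  ultimately show ?thesis by (simp add: less_eq_complex_def)
qed

lemma has_sum_sum:
  fixes f :: "'k \<Rightarrow> 'x \<Rightarrow> 'a::topological_comm_monoid_add"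
  assumes "\<And>k. k \<in> K \<Longrightarrow> (f k has_sum S k) A"
  shows "((\<lambda>x. \<Sum>k\<in>K. f k x) has_sum (\<Sum>k\<in>K. S k)) A"
  using assms by (induction K rule: infinite_finite_induct) (auto intro: has_sum_add has_sum_0)

lemma cinner_has_sum: "((\<lambda>i. coord x i * cnj (coord y i)) has_sum \<langle>x, y\<rangle>) UNIV"
  unfolding cinner.rep_eq l2inner_def by (intro has_sum_infsum l2_product_summable coord)

lemma tensor_nonneg_one:
  assumes "psd n F"
  shows "tensor_nonneg n F 1"
  unfolding tensor_nonneg_def
proof
  fix h :: "nat \<Rightarrow> 'i ell2"
  let ?f = "\<lambda>i. \<Sum>r<n. \<Sum>s<n. F r s * (coord (h s) i * cnj (coord (h r) i))"
  have sum: "(?f has_sum (\<Sum>r<n. \<Sum>s<n. F r s * \<langle>h s, h r\<rangle>)) UNIV"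
    by (intro has_sum_sum has_sum_cmult_right cinner_has_sum)
  have "0 \<le> ?f i" for i
    using assms unfolding psd_def by (auto dest: spec[where x = "\<lambda>r. coord (h r) i"] simp: mult_ac)
  then have "0 \<le> infsum ?f UNIV"
    using sum by (intro infsum_nonneg_complex has_sum_imp_summable)
  then show "0 \<le> (\<Sum>r<n. \<Sum>s<n. F r s * \<langle>1 \<cdot> h s, h r\<rangle>)"
    using sum by (simp add: infsumI)
qed

lemma tensor_nonneg_add: "tensor_nonneg n F S \<Longrightarrow> tensor_nonneg n F T \<Longrightarrow> tensor_nonneg n F (S + T)"
  by (simp add: tensor_nonneg_def cinner.add_left distrib_left sum.distrib)

lemma tensor_nonneg_sum: "(\<And>i. i \<in> I \<Longrightarrow> tensor_nonneg n F (Q i)) \<Longrightarrow> tensor_nonneg n F (\<Sum>i\<in>I. Q i)"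
proof (induction I rule: infinite_finite_induct)
  case (insert i I)
  then show ?case by (simp add: tensor_nonneg_add)
qed (simp_all add: tensor_nonneg_def cinner.zero_left)

lemma tensor_nonneg_scalar_mult: "0 \<le> c \<Longrightarrow> tensor_nonneg n F Q \<Longrightarrow> tensor_nonneg n F (scalar_op c * Q)"
  by (simp add: tensor_nonneg_def mult.left_commute[of _ c] flip: sum_distrib_left)

lemma tensor_nonneg_conj: "tensor_nonneg n F Q \<Longrightarrow> tensor_nonneg n F (star S * Q * S)"
  unfolding tensor_nonneg_def by (auto simp: cinner_star_left dest: spec[where x = "\<lambda>r. S \<cdot> _ r"])

lemma tensor_nonneg_limit:
  assumes "\<And>x. (\<lambda>k. Q k \<cdot> x) \<longlonglongrightarrow> T \<cdot> x" "\<And>k. tensor_nonneg n F (Q k)"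
  shows "tensor_nonneg n F T"
  unfolding tensor_nonneg_def
proof
  fix h
  have "(\<lambda>k. \<Sum>r<n. \<Sum>s<n. F r s * \<langle>Q k \<cdot> h s, h r\<rangle>) \<longlonglongrightarrow> (\<Sum>r<n. \<Sum>s<n. F r s * \<langle>T \<cdot> h s, h r\<rangle>)"
    by (intro tendsto_intros cinner.tendsto assms)
  then show "0 \<le> (\<Sum>r<n. \<Sum>s<n. F r s * \<langle>T \<cdot> h s, h r\<rangle>)"
    by (rule complex_nonneg_limit) (use assms(2) in \<open>simp add: tensor_nonneg_def\<close>)
qed

lemma tensor_nonneg_unit_interval_mult:
  fixes T :: "'i ell2_op"
  assumes T: "unit_interval T" and comm: "commute Q T" and Q: "tensor_nonneg n F Q"
  shows "tensor_nonneg n F (T * Q)"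
proof (rule tensor_nonneg_limit)
  let ?R = "riesz_remainder T"
  have star_R: "star (?R k) = ?R k" for k
    using unit_interval.unit_interval_riesz_remainder[OF T] by (rule unit_interval.star_eq)
  have comm_R: "Q * ?R k = ?R k * Q" for k
    using commute_riesz_remainder[OF comm] by (simp add: commute_def)
  show "tensor_nonneg n F (T * Q - ?R N * Q)" for N
  proof -
    have "T * Q - ?R N * Q = (\<Sum>k<N. ?R k * ?R k) * Q"
      by (subst (1) riesz_expansion[of T N]) (simp add: distrib_right)
    also have "\<dots> = (\<Sum>k<N. star (?R k) * Q * ?R k)"
      by (simp add: sum_distrib_right star_R mult.assoc comm_R)
    finally show ?thesis using Q by (simp only: tensor_nonneg_sum tensor_nonneg_conj)
  qed
  show "(\<lambda>N. (T * Q - ?R N * Q) \<cdot> x) \<longlonglongrightarrow> (T * Q) \<cdot> x" for x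
    using tendsto_diff[OF tendsto_const riesz_remainder_tendsto_0[OF T], of "(T * Q) \<cdot> x" "Q \<cdot> x"]
    by simp
qed

lemma tensor_nonneg_fejer_sum_mult:
  fixes A V :: "'i ell2_op"
  assumes A: "0 \<le> A" "A \<le> 1" and V: "star V * A * V \<le> A"
    and comm: "commute Q A" "commute Q V" "commute Q (star V)" and Q: "tensor_nonneg n F Q"
  shows "tensor_nonneg n F (fejer_sum A V N * Q)"
proof -
  let ?G = "geometric_sum V" and ?D = "A - star V * A * V"
  have "unit_interval A" using A by unfold_locales
  then have AQ: "tensor_nonneg n F (A * Q)"
    using comm Q by (intro tensor_nonneg_unit_interval_mult)
  have "0 \<le> star V * A * V" using A by (intro conj_nonneg)
  then have "?D \<le> 1" using A by (simp add: diff_le_eq add_increasing2)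
  then have "unit_interval ?D" using V by unfold_locales auto
  then have DQ: "tensor_nonneg n F (?D * Q)"
    using comm Q by (intro tensor_nonneg_unit_interval_mult commute_diff commute_mult)
  have comm_G: "?G j * Q = Q * ?G j" for j
    using commute_geometric_sum[OF comm(2)] by (simp add: commute_def)
  have "fejer_sum A V N * Q
      = star (?G N) * (A * Q) * ?G N + (\<Sum>j<N. star (?G j) * (?D * Q) * ?G j)"
    unfolding fejer_sum_eq_sum_conj distrib_right sum_distrib_right
    by (simp only: mult.assoc comm_G)
  then show ?thesis
    using AQ DQ by (simp only: tensor_nonneg_add tensor_nonneg_sum tensor_nonneg_conj)
qed

section \<open>Commuting Toeplitz pairs\<close>

definition torus_eval :: "(int \<Rightarrow> int \<Rightarrow> cmat) \<Rightarrow> complex \<Rightarrow> complex \<Rightarrow> cmat" where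
  "torus_eval X z w r s = (\<Sum>a\<in>Dexp. \<Sum>b\<in>Dexp. X a b r s * z powi a * w powi b)"

lemma min_pos_iff_torus_eval:
  "min_pos n X \<longleftrightarrow> (\<forall>z w. cmod z = 1 \<longrightarrow> cmod w = 1 \<longrightarrow> psd n (torus_eval X z w))"
  unfolding min_pos_def torus_eval_def ..

definition product_form ::
  "nat \<Rightarrow> (int \<Rightarrow> int \<Rightarrow> cmat) \<Rightarrow> (int \<Rightarrow> 'i ell2_op) \<Rightarrow> (int \<Rightarrow> 'i ell2_op) \<Rightarrow> (nat \<Rightarrow> 'i ell2) \<Rightarrow> complex"
  where "product_form n X f g h =
    (\<Sum>r<n. \<Sum>s<n. \<Sum>a\<in>Dexp. \<Sum>b\<in>Dexp. X a b r s * \<langle>(f a * g b) \<cdot> h s, h r\<rangle>)"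

lemma product_form_weighted_points_nonneg:
  fixes P :: "'k \<Rightarrow> 'i ell2_op" and Q :: "'l \<Rightarrow> 'i ell2_op"
  assumes X: "min_pos n X"
    and unimodular: "\<And>m. cmod (\<zeta> m) = 1" "\<And>l. cmod (\<omega> l) = 1"
    and weights: "\<And>m l F. psd n F \<Longrightarrow> tensor_nonneg n F (P m * Q l)"
  shows "0 \<le> product_form n X (\<lambda>a. \<Sum>m\<in>M. scalar_op (\<zeta> m powi a) * P m)
    (\<lambda>b. \<Sum>l\<in>L. scalar_op (\<omega> l powi b) * Q l) h"
proof -
  let ?f = "\<lambda>a. \<Sum>m\<in>M. scalar_op (\<zeta> m powi a) * P m"
  let ?g = "\<lambda>b. \<Sum>l\<in>L. scalar_op (\<omega> l powi b) * Q l"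
  let ?F = "\<lambda>(m, l). torus_eval X (\<zeta> m) (\<omega> l)" and ?PQ = "\<lambda>(m, l). P m * Q l"
  have "?f a * ?g b = (\<Sum>p\<in>M \<times> L. scalar_op (\<zeta> (fst p) powi a * \<omega> (snd p) powi b) * ?PQ p)" for a b
    unfolding sum_product sum.cartesian_product by (simp only: case_prod_unfold scalar_op_mult_mult)
  then have "\<langle>(?f a * ?g b) \<cdot> x, y\<rangle>
      = (\<Sum>p\<in>M \<times> L. \<zeta> (fst p) powi a * \<omega> (snd p) powi b * \<langle>?PQ p \<cdot> x, y\<rangle>)" for a b x y
    by (simp only: apply_op_sum cinner.sum_left cinner_scalar_op_mult)
  then have "(\<Sum>a\<in>Dexp. \<Sum>b\<in>Dexp. X a b r s * \<langle>(?f a * ?g b) \<cdot> h s, h r\<rangle>)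
      = (\<Sum>p\<in>M \<times> L. ?F p r s * \<langle>?PQ p \<cdot> h s, h r\<rangle>)" for r s
    by (simp add: torus_eval_def case_prod_unfold Dexp_def sum_distrib_left sum.distrib
        algebra_simps del: times_ell2_op.rep_eq)
  then have "product_form n X ?f ?g h = (\<Sum>r<n. \<Sum>s<n. \<Sum>p\<in>M \<times> L. ?F p r s * \<langle>?PQ p \<cdot> h s, h r\<rangle>)"
    by (simp only: product_form_def)
  also have "\<dots> = (\<Sum>r<n. \<Sum>p\<in>M \<times> L. \<Sum>s<n. ?F p r s * \<langle>?PQ p \<cdot> h s, h r\<rangle>)"
    by (intro sum.cong refl sum.swap)
  also have "\<dots> = (\<Sum>p\<in>M \<times> L. \<Sum>r<n. \<Sum>s<n. ?F p r s * \<langle>?PQ p \<cdot> h s, h r\<rangle>)"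
    by (rule sum.swap)
  also have "\<dots> \<ge> 0"
  proof (rule sum_nonneg)
    fix p
    have "psd n (?F p)"
      using X unimodular by (simp add: min_pos_iff_torus_eval case_prod_unfold)
    then have "tensor_nonneg n (?F p) (?PQ p)"
      using weights by (simp add: case_prod_unfold)
    then show "0 \<le> (\<Sum>r<n. \<Sum>s<n. ?F p r s * \<langle>?PQ p \<cdot> h s, h r\<rangle>)"
      unfolding tensor_nonneg_def by blast
  qed
  finally show ?thesis .
qed

lemma product_form_nonneg_limit:
  assumes "\<And>a x. a \<in> Dexp \<Longrightarrow> (\<lambda>k. star (f k a) \<cdot> x) \<longlonglongrightarrow> star (f' a) \<cdot> x"
    and "\<And>b x. b \<in> Dexp \<Longrightarrow> (\<lambda>k. g k b \<cdot> x) \<longlonglongrightarrow> g' b \<cdot> x"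
    and "\<And>k. 0 \<le> product_form n X (f k) (g k) h"
  shows "0 \<le> product_form n X f' g' h"
proof (rule complex_nonneg_limit)
  have move: "\<langle>(S * T) \<cdot> x, y\<rangle> = \<langle>T \<cdot> x, star S \<cdot> y\<rangle>" for S T :: "'a ell2_op" and x y
    by (simp add: cinner_star_right)
  show "(\<lambda>k. product_form n X (f k) (g k) h) \<longlonglongrightarrow> product_form n X f' g' h"
    unfolding product_form_def move by (intro tendsto_intros cinner.tendsto assms)
qed (rule assms)

definition uroot :: "nat \<Rightarrow> nat \<Rightarrow> complex" where
  "uroot M m = cis (2 * pi * real m / real M)"

lemma norm_uroot [simp]: "cmod (uroot M m) = 1"
  by (simp add: uroot_def)

lemma sum_uroot_powi:
  assumes "\<bar>k\<bar> < int M"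
  shows "(\<Sum>m<M. uroot M m powi k) = (if k = 0 then of_nat M else 0)"
proof (cases "k = 0")
  case False
  have M_pos: "M > 0" using assms by linarith
  define x where "x = cis (2 * pi * real_of_int k / real M)"
  have "uroot M m powi k = x ^ m" for m
    by (simp add: uroot_def x_def cis_power_int Complex.DeMoivre mult_ac)
  moreover have "x \<noteq> 1"
  proof
    assume "x = 1"
    then have "cos (2 * pi * real_of_int k / real M) = 1"
      by (simp add: x_def complex_eq_iff)
    then obtain n where "2 * pi * real_of_int k / real M = of_int n * 2 * pi"
      using cos_one_2pi_int by auto
    then have "real_of_int k = real_of_int (n * int M)"
      using M_pos by (simp add: field_simps)
    then have "k = n * int M" by (simp only: of_int_eq_iff)
    then show False using assms False by (simp add: abs_mult)
  qed
  moreover have "x ^ M = 1"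
    using M_pos by (simp add: x_def Complex.DeMoivre cis_multiple_2pi)
  ultimately show ?thesis using False by (simp add: geometric_sum)
qed simp

lemma cnj_eq_inverse:
  assumes "cmod z = 1"
  shows "cnj z = inverse z"
  using assms by (simp add: inverse_complex_def complex_eq_iff cmod_def)

lemma moment_scalar_mult:
  assumes "cmod c = 1"
  shows "moment A (scalar_op c * W) k = scalar_op (c powi k) * moment A W k"
proof -
  have "star (scalar_op c * W) = scalar_op (inverse c) * star W"
    using assms by (simp add: scalar_op_commute cnj_eq_inverse)
  then show ?thesis
    by (simp add: moment_def scalar_op_mult_power scalar_op_commute_left[of A] power_int_def
        mult.assoc)
qed

lemma fejer_sum_average:
  assumes "\<bar>a\<bar> + int N \<le> int M"
  shows "(\<Sum>m<M. scalar_op (uroot M m powi a) * fejer_sum A (scalar_op (cnj (uroot M m)) * W) N)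
    = scalar_op (of_nat M * of_nat (N - nat \<bar>a\<bar>)) * moment A W a"
proof -
  let ?\<zeta> = "uroot M"
  let ?term = "\<lambda>m i j. scalar_op (?\<zeta> m powi (a - (int j - int i))) * moment A W (int j - int i)"
  have powers: "?\<zeta> m powi a * cnj (?\<zeta> m) powi k = ?\<zeta> m powi (a - k)" for m k
  proof -
    have "?\<zeta> m \<noteq> 0" by (metis norm_uroot norm_zero zero_neq_one)
    then show ?thesis
      by (simp add: cnj_eq_inverse power_int_diff power_int_inverse divide_inverse)
  qed
  have "scalar_op (?\<zeta> m powi a) * fejer_sum A (scalar_op (cnj (?\<zeta> m)) * W) N
      = (\<Sum>i<N. \<Sum>j<N. ?term m i j)" for m
    by (simp add: fejer_sum_def moment_scalar_mult sum_distrib_left scalar_op_mult_left powers)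
  then have "(\<Sum>m<M. scalar_op (?\<zeta> m powi a) * fejer_sum A (scalar_op (cnj (?\<zeta> m)) * W) N)
      = (\<Sum>m<M. \<Sum>i<N. \<Sum>j<N. ?term m i j)"
    by simp
  also have "\<dots> = (\<Sum>i<N. \<Sum>m<M. \<Sum>j<N. ?term m i j)"
    by (rule sum.swap)
  also have "\<dots> = (\<Sum>i<N. \<Sum>j<N. \<Sum>m<M. ?term m i j)"
    by (intro sum.cong refl sum.swap)
  also have "\<dots> = (\<Sum>i<N. \<Sum>j<N. if int j - int i = a then scalar_op (of_nat M) * moment A W a else 0)"
  proof (intro sum.cong refl)
    fix i j assume "i \<in> {..<N}" "j \<in> {..<N}"
    then have "\<bar>a - (int j - int i)\<bar> < int M" using assms by auto
    then have "scalar_op (\<Sum>m<M. ?\<zeta> m powi (a - (int j - int i))) * moment A W (int j - int i)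
        = (if int j - int i = a then scalar_op (of_nat M) * moment A W a else 0)"
      by (simp add: sum_uroot_powi)
    then show "(\<Sum>m<M. ?term m i j)
        = (if int j - int i = a then scalar_op (of_nat M) * moment A W a else 0)"
      by (simp only: scalar_op_sum sum_distrib_right)
  qed
  also have "\<dots> = scalar_op (of_nat M * of_nat (N - nat \<bar>a\<bar>)) * moment A W a"
    unfolding fejer_multiplicity
    by (simp add: scalar_op_mult_left mult.commute flip: scalar_op_of_nat)
  finally show ?thesis .
qed

definition symbol :: "'a::star_ring \<Rightarrow> 'a \<Rightarrow> int \<Rightarrow> 'a" where
  "symbol A B a = (if a = 0 then A else if a = 1 then B else star B)"

lemma symbol_simps [simp]: "symbol A B 0 = A" "symbol A B 1 = B" "symbol A B (- 1) = star B"
  by (simp_all add: symbol_def)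

lemma Dexp_cases:
  assumes "a \<in> Dexp"
  obtains "a = 0" | "a = 1" | "a = -1"
  using assms by (auto simp: Dexp_def)

lemma Dexp_mem [simp]: "0 \<in> Dexp" "1 \<in> Dexp" "-1 \<in> Dexp"
  by (auto simp: Dexp_def)

lemma uminus_mem_Dexp: "a \<in> Dexp \<Longrightarrow> - a \<in> Dexp"
  by (auto simp: Dexp_def)

lemma star_symbol: "star A = A \<Longrightarrow> a \<in> Dexp \<Longrightarrow> star (symbol A B a) = symbol A B (- a)"
  by (auto elim: Dexp_cases)

locale ell2_toeplitz_pair = toeplitz_pair A B for A B :: "'i ell2_op"
begin

text \<open>With \<open>K + 2\<close> roots of unity, the frequencies \<open>-K, \<dots>, K\<close> of a Fejer sum of length \<open>K + 1\<close> do not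
  alias after a shift by \<open>a \<in> {-1, 0, 1}\<close>.\<close>

definition fejer_weight :: "nat \<Rightarrow> nat \<Rightarrow> 'i ell2_op" where
  "fejer_weight K m = scalar_op (inverse (of_nat (Suc (Suc K)) * of_nat (Suc K)))
    * fejer_sum A (scalar_op (cnj (uroot (Suc (Suc K)) m)) * quotient K) (Suc K)"

definition fejer_approx :: "nat \<Rightarrow> int \<Rightarrow> 'i ell2_op" where
  "fejer_approx K a = (\<Sum>m<Suc (Suc K). scalar_op (uroot (Suc (Suc K)) m powi a) * fejer_weight K m)"

lemma commute_fejer_arguments:
  assumes "commute S A" "commute S B" "commute S (star B)"
  shows "commute S (scalar_op c * quotient K)" "commute S (star (scalar_op c * quotient K))"
  unfolding star_mult star_scalar_op
  by (intro commute_mult commute_scalar_op commute_quotient commute_star_quotient assms)+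

lemma commute_fejer_weight:
  assumes "commute S A" "commute S B" "commute S (star B)"
  shows "commute S (fejer_weight K m)"
  unfolding fejer_weight_def
  by (intro commute_mult commute_scalar_op commute_fejer_sum commute_fejer_arguments assms)

lemma tensor_nonneg_fejer_weight_mult:
  assumes "commute Q A" "commute Q B" "commute Q (star B)" and "tensor_nonneg n F Q"
  shows "tensor_nonneg n F (fejer_weight K m * Q)"
proof -
  define c where "c = cnj (uroot (Suc (Suc K)) m)"
  have "cnj c * c = 1"
    by (simp add: c_def mult.commute flip: complex_norm_square)
  then have "star (scalar_op c * quotient K) * A * (scalar_op c * quotient K)
      = star (quotient K) * A * quotient K"
    by (simp add: mult.assoc scalar_op_commute_left[of A] scalar_op_mult_left)
  then have "star (scalar_op c * quotient K) * A * (scalar_op c * quotient K) \<le> A"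
    using quotient_contraction by simp
  then have "tensor_nonneg n F (fejer_sum A (scalar_op c * quotient K) (Suc K) * Q)"
    using assms by (intro tensor_nonneg_fejer_sum_mult A_nonneg A_le_1 commute_fejer_arguments)
  moreover have "0 \<le> inverse (of_nat (Suc (Suc K)) * of_nat (Suc K) :: complex)"
    by (simp add: less_eq_complex_def flip: of_nat_mult)
  ultimately show ?thesis
    unfolding fejer_weight_def c_def mult.assoc by (intro tensor_nonneg_scalar_mult)
qed

lemma fejer_approx_eq:
  assumes "a \<in> Dexp"
  shows "fejer_approx K a
    = scalar_op (of_nat (Suc K - nat \<bar>a\<bar>) / of_nat (Suc K)) * moment A (quotient K) a"
proof -
  let ?M = "Suc (Suc K)" and ?d = "inverse (of_nat (Suc (Suc K)) * of_nat (Suc K)) :: complex"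
  have "fejer_approx K a = scalar_op ?d * (\<Sum>m<?M. scalar_op (uroot ?M m powi a)
      * fejer_sum A (scalar_op (cnj (uroot ?M m)) * quotient K) (Suc K))"
    by (simp only: fejer_approx_def fejer_weight_def sum_distrib_left scalar_op_mult_left
        mult.commute)
  also have "\<dots> = scalar_op (?d * (of_nat ?M * of_nat (Suc K - nat \<bar>a\<bar>))) * moment A (quotient K) a"
    using assms by (subst fejer_sum_average) (auto simp: Dexp_def scalar_op_mult_left)
  also have "?d * (of_nat ?M * of_nat (Suc K - nat \<bar>a\<bar>))
      = of_nat (Suc K - nat \<bar>a\<bar>) / of_nat (Suc K)"
    by (simp add: field_simps del: of_nat_Suc)
  finally show ?thesis .
qed

lemma star_fejer_approx:
  assumes "a \<in> Dexp"
  shows "star (fejer_approx K a) = fejer_approx K (- a)"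
  using assms
  by (simp add: fejer_approx_eq uminus_mem_Dexp star_moment scalar_op_commute del: of_nat_Suc)

lemma moment_quotient_tendsto:
  assumes "a \<in> Dexp"
  shows "(\<lambda>K. moment A (quotient K) a \<cdot> x) \<longlonglongrightarrow> symbol A B a \<cdot> x"
  using assms
proof (cases rule: Dexp_cases)
  case 2
  have "(\<lambda>K. B \<cdot> x - (remainder K * B) \<cdot> x) \<longlonglongrightarrow> B \<cdot> x - 0"
    by (intro tendsto_diff tendsto_const tendsto_0_of_scaled_square_le_one remainder_B_small)
  then show ?thesis using 2 by (simp add: moment_def A_quotient)
next
  case 3
  have "(\<lambda>K. star B \<cdot> x - (star B * remainder K) \<cdot> x) \<longlonglongrightarrow> star B \<cdot> x - 0"
    by (intro tendsto_diff tendsto_const tendsto_0_of_scaled_square_le_one star_B_remainder_small)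
  then show ?thesis using 3 by (simp add: moment_def star_quotient_A)
qed (simp add: moment_def)

lemma fejer_approx_tendsto:
  assumes "a \<in> Dexp"
  shows "(\<lambda>K. fejer_approx K a \<cdot> x) \<longlonglongrightarrow> symbol A B a \<cdot> x"
proof -
  have "(\<lambda>K. of_nat (Suc K - nat \<bar>a\<bar>) / of_nat (Suc K)) \<longlonglongrightarrow> (1 :: complex)"
  proof (cases "a = 0")
    case False
    then have "nat \<bar>a\<bar> = 1" using assms by (auto simp: Dexp_def)
    then show ?thesis using LIMSEQ_n_over_Suc_n[where 'a = complex] by simp
  qed (simp del: of_nat_Suc)
  from cscale.tendsto[OF this moment_quotient_tendsto[OF assms, of x]] show ?thesis
    using assms by (simp add: fejer_approx_eq del: of_nat_Suc)
qed

end

proposition toeplitz_pairs_product_form_nonneg: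
  fixes A B A' B' :: "'i ell2_op"
  assumes "toeplitz_pair A B" "toeplitz_pair A' B'"
    and comm: "\<And>a b. a \<in> Dexp \<Longrightarrow> b \<in> Dexp \<Longrightarrow> commute (symbol A B a) (symbol A' B' b)"
    and X: "min_pos n X"
  shows "0 \<le> product_form n X (symbol A B) (symbol A' B') h"
proof -
  interpret p: ell2_toeplitz_pair A B by (intro ell2_toeplitz_pair.intro assms)
  interpret q: ell2_toeplitz_pair A' B' by (intro ell2_toeplitz_pair.intro assms)
  have comm_q: "commute (symbol A B a) (q.fejer_weight K l)" if "a \<in> Dexp" for a K l
    using comm[OF that, of 0] comm[OF that, of 1] comm[OF that, of "-1"]
    by (intro q.commute_fejer_weight) auto
  have weights: "tensor_nonneg n F (p.fejer_weight K m * q.fejer_weight K l)"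
    if "psd n F" for F K m l
  proof (rule p.tensor_nonneg_fejer_weight_mult)
    show "commute (q.fejer_weight K l) A" "commute (q.fejer_weight K l) B"
      "commute (q.fejer_weight K l) (star B)"
      using comm_q[of 0] comm_q[of 1] comm_q[of "-1"] by (auto intro: commute_sym)
    have "tensor_nonneg n F (q.fejer_weight K l * 1)"
      using that by (intro q.tensor_nonneg_fejer_weight_mult tensor_nonneg_one)
        (simp_all add: commute_def)
    then show "tensor_nonneg n F (q.fejer_weight K l)" by simp
  qed
  show ?thesis
  proof (rule product_form_nonneg_limit)
    show "(\<lambda>K. star (p.fejer_approx K a) \<cdot> x) \<longlonglongrightarrow> star (symbol A B a) \<cdot> x" if "a \<in> Dexp" for a x
      using p.fejer_approx_tendsto[OF uminus_mem_Dexp[OF that]] that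
      by (simp add: p.star_fejer_approx star_symbol)
    show "(\<lambda>K. q.fejer_approx K b \<cdot> x) \<longlonglongrightarrow> symbol A' B' b \<cdot> x" if "b \<in> Dexp" for b x
      using that by (rule q.fejer_approx_tendsto)
    show "0 \<le> product_form n X (p.fejer_approx K) (q.fejer_approx K) h" for K
      unfolding p.fejer_approx_def q.fejer_approx_def
      using X weights by (intro product_form_weighted_points_nonneg) auto
  qed
qed

section \<open>Completely positive maps\<close>

lemma toeplitz_pairI:
  fixes A B :: "'i ell2_op"
  assumes "A \<le> 1"
    and "\<And>x y. 0 \<le> \<langle>A \<cdot> x, x\<rangle> + \<langle>A \<cdot> y, y\<rangle> + \<langle>B \<cdot> y, x\<rangle> + \<langle>star B \<cdot> x, y\<rangle>"
  shows "toeplitz_pair A B"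
proof
  show "0 \<le> star S * A * S + star T * A * T + star S * B * T + star T * star B * S" for S T
    using assms(2) by (simp add: less_eq_ell2_op_def cinner.add_left cinner_star_left)
qed (rule assms)

locale toeplitz_map =
  fixes f :: "int \<Rightarrow> 'i ell2 \<Rightarrow> 'i ell2"
  assumes map_add: "a \<in> Dexp \<Longrightarrow> f a (x + y) = f a x + f a y"
    and map_cscale: "a \<in> Dexp \<Longrightarrow> f a (c *\<^sub>C x) = c *\<^sub>C f a x"
    and toeplitz_nonneg: "0 \<le> \<langle>f 0 x, x\<rangle> + \<langle>f 0 y, y\<rangle> + \<langle>f 1 y, x\<rangle> + \<langle>f (- 1) x, y\<rangle>"
    and bounded: "\<exists>C. \<forall>x. Re \<langle>f 0 x, x\<rangle> \<le> C * (norm x)\<^sup>2"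
begin

lemma map_zero: "a \<in> Dexp \<Longrightarrow> f a 0 = 0"
  using map_cscale[of a 0 0] by (simp add: cscale.zero_left)

lemma diagonal_nonneg: "0 \<le> \<langle>f 0 x, x\<rangle>"
  using toeplitz_nonneg[of x 0] by (simp add: map_zero cinner.zero_left cinner.zero_right)

lemma self_adjoint: "\<langle>f 0 x, y\<rangle> = \<langle>x, f 0 y\<rangle>"
proof (rule adjoint_of_real_sum)
  show "Im (\<langle>f 0 v, u\<rangle> + \<langle>f 0 u, v\<rangle>) = 0" for u v
    using diagonal_nonneg[of "u + v"] diagonal_nonneg[of u] diagonal_nonneg[of v]
    by (simp add: map_add cinner.add_left cinner.add_right less_eq_complex_def)
qed (simp add: map_cscale)

lemma adjoint: "\<langle>f (- 1) x, y\<rangle> = \<langle>x, f 1 y\<rangle>"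
proof (rule adjoint_of_real_sum)
  show "Im (\<langle>f 1 v, u\<rangle> + \<langle>f (- 1) u, v\<rangle>) = 0" for u v
    using toeplitz_nonneg[of u v] diagonal_nonneg[of u] diagonal_nonneg[of v]
    by (simp add: less_eq_complex_def)
qed (simp add: map_cscale)

lemma symbol_representation:
  obtains d A B where "d > 0" "toeplitz_pair A B"
    "\<And>a x. a \<in> Dexp \<Longrightarrow> f a x = complex_of_real d *\<^sub>C symbol A B a \<cdot> x"
proof -
  obtain C where C: "Re \<langle>f 0 x, x\<rangle> \<le> C * (norm x)\<^sup>2" for x using bounded by blast
  define d where "d = max C 1"
  have d_pos: "d > 0" by (simp add: d_def)
  define A where "A = scalar_op (1 / d) * Abs_ell2_op (f 0)"
  define B where "B = scalar_op (1 / d) * Abs_ell2_op (f 1)"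
  have "Abs_ell2_op (f 0) \<cdot> x = f 0 x" for x
    using self_adjoint by (subst Abs_ell2_op_inverse) auto
  then have A_apply: "A \<cdot> x = complex_of_real (1 / d) *\<^sub>C f 0 x" for x by (simp add: A_def)
  have adjoint_right: "\<langle>f 1 x, y\<rangle> = \<langle>x, f (- 1) y\<rangle>" for x y
    by (metis adjoint cinner_commute)
  then have "Abs_ell2_op (f 1) \<cdot> x = f 1 x" for x
    by (subst Abs_ell2_op_inverse) auto
  then have B_apply: "B \<cdot> x = complex_of_real (1 / d) *\<^sub>C f 1 x" for x by (simp add: B_def)
  have star_B_apply: "star B \<cdot> x = complex_of_real (1 / d) *\<^sub>C f (- 1) x" for x
    by (rule cinner_ext) (simp add: cinner_star_left B_apply adjoint)
  have "toeplitz_pair A B"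
  proof (rule toeplitz_pairI)
    fix x y
    have "0 \<le> complex_of_real (1 / d) * (\<langle>f 0 x, x\<rangle> + \<langle>f 0 y, y\<rangle> + \<langle>f 1 y, x\<rangle> + \<langle>f (- 1) x, y\<rangle>)"
      using d_pos by (intro mult_nonneg_nonneg toeplitz_nonneg) (simp add: less_eq_complex_def)
    then show "0 \<le> \<langle>A \<cdot> x, x\<rangle> + \<langle>A \<cdot> y, y\<rangle> + \<langle>B \<cdot> y, x\<rangle> + \<langle>star B \<cdot> x, y\<rangle>"
      by (simp add: A_apply B_apply star_B_apply distrib_left add_divide_distrib)
    have "Re \<langle>f 0 z, z\<rangle> \<le> d * (norm z)\<^sup>2" for z
      using C[of z] by (rule order_trans) (simp add: d_def mult_right_mono)
    then show "A \<le> 1"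
      using d_pos diagonal_nonneg
      by (simp add: less_eq_ell2_op_def A_apply cinner.diff_left cinner_self_norm
          less_eq_complex_def field_simps)
  qed
  moreover have "f a x = complex_of_real d *\<^sub>C symbol A B a \<cdot> x" if "a \<in> Dexp" for a x
    using that d_pos
    by (cases rule: Dexp_cases)
       (simp_all add: A_apply B_apply star_B_apply flip: of_real_mult)
  ultimately show thesis using that d_pos by blast
qed

end

lemma commuting_toeplitz_maps_nonneg:
  assumes "toeplitz_map f" "toeplitz_map g"
    and comm: "\<And>a b x. a \<in> Dexp \<Longrightarrow> b \<in> Dexp \<Longrightarrow> f a (g b x) = g b (f a x)"
    and X: "min_pos n X"
  shows "0 \<le> (\<Sum>r<n. \<Sum>s<n. \<Sum>a\<in>Dexp. \<Sum>b\<in>Dexp. X a b r s * \<langle>f a (g b (h s)), h r\<rangle>)"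
proof -
  interpret f: toeplitz_map f by fact
  interpret g: toeplitz_map g by fact
  obtain d A B where rep_f: "d > 0" "toeplitz_pair A B"
    "\<And>a x. a \<in> Dexp \<Longrightarrow> f a x = complex_of_real d *\<^sub>C symbol A B a \<cdot> x"
    using f.symbol_representation by metis
  obtain e A' B' where rep_g: "e > 0" "toeplitz_pair A' B'"
    "\<And>b x. b \<in> Dexp \<Longrightarrow> g b x = complex_of_real e *\<^sub>C symbol A' B' b \<cdot> x"
    using g.symbol_representation by metis
  have fg: "f a (g b x) = complex_of_real (d * e) *\<^sub>C (symbol A B a * symbol A' B' b) \<cdot> x"
    and gf: "g b (f a x) = complex_of_real (d * e) *\<^sub>C (symbol A' B' b * symbol A B a) \<cdot> x"
    if "a \<in> Dexp" "b \<in> Dexp" for a b x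
    using that by (simp_all add: rep_f(3) rep_g(3) apply_op_cscale mult.commute)
  have "commute (symbol A B a) (symbol A' B' b)" if ab: "a \<in> Dexp" "b \<in> Dexp" for a b
    unfolding commute_def
  proof (rule ell2_op_eqI)
    fix x y
    have "complex_of_real (d * e) * \<langle>(symbol A B a * symbol A' B' b) \<cdot> x, y\<rangle>
        = complex_of_real (d * e) * \<langle>(symbol A' B' b * symbol A B a) \<cdot> x, y\<rangle>"
      using comm[OF ab, of x] unfolding fg[OF ab] gf[OF ab] by (metis cinner_cscale_left)
    then show "\<langle>(symbol A B a * symbol A' B' b) \<cdot> x, y\<rangle> = \<langle>(symbol A' B' b * symbol A B a) \<cdot> x, y\<rangle>"
      using rep_f(1) rep_g(1) by simp
  qed
  from toeplitz_pairs_product_form_nonneg[OF rep_f(2) rep_g(2) this X]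
  have "0 \<le> complex_of_real (d * e) * product_form n X (symbol A B) (symbol A' B') h"
    using rep_f(1) rep_g(1) by (intro mult_nonneg_nonneg) (simp_all add: less_eq_complex_def)
  also have "\<dots> = (\<Sum>r<n. \<Sum>s<n. \<Sum>a\<in>Dexp. \<Sum>b\<in>Dexp. X a b r s * \<langle>f a (g b (h s)), h r\<rangle>)"
    unfolding product_form_def sum_distrib_left
    by (intro sum.cong refl) (simp only: fg cinner_cscale_left mult.left_commute)
  finally show ?thesis .
qed

text \<open>A single map is paired with integration over the circle, which commutes with every map.\<close>

lemma toeplitz_map_nonneg:
  assumes "toeplitz_map f" and P: "S1_pos k P"
  shows "0 \<le> (\<Sum>i<k. \<Sum>j<k. \<Sum>a\<in>Dexp. P a i j * \<langle>f a (h j), h i\<rangle>)"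
proof -
  interpret f: toeplitz_map f by fact
  define g :: "int \<Rightarrow> 'a ell2 \<Rightarrow> 'a ell2" where "g b x = (if b = 0 then x else 0)" for b x
  define X where "X a b = (if b = 0 then P a else (\<lambda>_ _. 0))" for a b :: int
  have toeplitz_map_g: "toeplitz_map g"
  proof
    show "0 \<le> \<langle>g 0 x, x\<rangle> + \<langle>g 0 y, y\<rangle> + \<langle>g 1 y, x\<rangle> + \<langle>g (- 1) x, y\<rangle>" for x y
      by (simp add: g_def cinner.zero_left cinner_self_norm less_eq_complex_def)
    show "\<exists>C. \<forall>x. Re \<langle>g 0 x, x\<rangle> \<le> C * (norm x)\<^sup>2"
      by (intro exI[of _ 1]) (simp add: g_def cinner_self_norm)
  qed (simp_all add: g_def cscale.zero_right)
  have "min_pos k X"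
    using P by (simp add: min_pos_def S1_pos_def X_def Dexp_def)
  moreover have "f a (g b x) = g b (f a x)" if "a \<in> Dexp" for a b x
    using that by (simp add: g_def f.map_zero)
  ultimately have "0 \<le> (\<Sum>i<k. \<Sum>j<k. \<Sum>a\<in>Dexp. \<Sum>b\<in>Dexp. X a b i j * \<langle>f a (g b (h j)), h i\<rangle>)"
    using toeplitz_map_g assms(1) by (intro commuting_toeplitz_maps_nonneg)
  then show ?thesis by (simp add: X_def g_def Dexp_def)
qed

lemma op_psd_iff_cinner:
  assumes "\<And>r s x. T r s (coord x) = coord (S r s x)"
  shows "op_psd n T \<longleftrightarrow> (\<forall>h. 0 \<le> (\<Sum>r<n. \<Sum>s<n. \<langle>S r s (h s), h r\<rangle>))"
proof
  assume op_psd: "op_psd n T"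
  have "0 \<le> (\<Sum>r<n. \<Sum>s<n. l2inner (T r s (coord (h s))) (coord (h r)))" for h
    by (rule op_psd[unfolded op_psd_def, rule_format]) (rule coord)
  then show "\<forall>h. 0 \<le> (\<Sum>r<n. \<Sum>s<n. \<langle>S r s (h s), h r\<rangle>)"
    by (simp add: assms cinner.rep_eq)
next
  assume nonneg: "\<forall>h. 0 \<le> (\<Sum>r<n. \<Sum>s<n. \<langle>S r s (h s), h r\<rangle>)"
  show "op_psd n T"
    unfolding op_psd_def
  proof (intro allI impI)
    fix h :: "nat \<Rightarrow> 'a \<Rightarrow> complex"
    assume h: "\<forall>j<n. h j \<in> l2"
    have "l2inner (T r s (h s)) (h r) = \<langle>S r s (Abs_ell2 (h s)), Abs_ell2 (h r)\<rangle>"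
      if "r < n" "s < n" for r s
      using h that assms[of r s "Abs_ell2 (h s)"] by (simp add: cinner.rep_eq Abs_ell2_inverse)
    then show "0 \<le> (\<Sum>r<n. \<Sum>s<n. l2inner (T r s (h s)) (h r))"
      using nonneg by simp
  qed
qed

definition lift_map :: "(('i \<Rightarrow> complex) \<Rightarrow> ('i \<Rightarrow> complex)) \<Rightarrow> 'i ell2 \<Rightarrow> 'i ell2" where
  "lift_map T x = Abs_ell2 (T (coord x))"

lemma coord_lift_map: "bounded_op T \<Longrightarrow> coord (lift_map T x) = T (coord x)"
  using coord[of x] by (simp add: lift_map_def bounded_op_def Abs_ell2_inverse)

lemma cp_S1_iff:
  assumes "\<And>a. a \<in> Dexp \<Longrightarrow> bounded_op (\<Phi> a)"
  shows "cp_S1 \<Phi> \<longleftrightarrow> (\<forall>k P. S1_pos k P \<longrightarrow>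
    (\<forall>h. 0 \<le> (\<Sum>i<k. \<Sum>j<k. \<Sum>a\<in>Dexp. P a i j * \<langle>lift_map (\<Phi> a) (h j), h i\<rangle>)))"
proof -
  have "op_psd k (\<lambda>i j f t. \<Sum>a\<in>Dexp. P a i j * \<Phi> a f t) \<longleftrightarrow>
      (\<forall>h. 0 \<le> (\<Sum>i<k. \<Sum>j<k. \<langle>\<Sum>a\<in>Dexp. P a i j *\<^sub>C lift_map (\<Phi> a) (h j), h i\<rangle>))" for k P
    by (rule op_psd_iff_cinner) (simp add: fun_eq_iff coord_sum cscale.rep_eq coord_lift_map assms)
  then show ?thesis
    using assms by (simp add: cp_S1_def cinner.sum_left)
qed

definition toeplitz_generator :: "int \<Rightarrow> cmat" where
  "toeplitz_generator a i j = (if a = int j - int i then 1 else 0)"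

lemma S1_pos_toeplitz_generator: "S1_pos 2 toeplitz_generator"
  unfolding S1_pos_def psd_iff_psd_on
proof (intro allI impI)
  fix z :: complex
  assume z: "cmod z = 1"
  then have "z \<noteq> 0" by auto
  then show "psd_on {..<2} (\<lambda>i j. \<Sum>a\<in>Dexp. toeplitz_generator a i j * z powi a)"
    using z by (intro psd_on_gram[where L = "{()}" and G = "\<lambda>_ i. z ^ i"])
      (auto simp: less_2_cases_iff Dexp_def toeplitz_generator_def cnj_eq_inverse)
qed

lemma toeplitz_map_lift_map:
  assumes "cp_S1 \<Phi>"
  shows "toeplitz_map (\<lambda>a. lift_map (\<Phi> a))"
proof
  let ?f = "\<lambda>a. lift_map (\<Phi> a)"
  have bounded: "bounded_op (\<Phi> a)" if "a \<in> Dexp" for a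
    using assms that by (simp add: cp_S1_def)
  fix x y :: "'a ell2"
  show "?f a (x + y) = ?f a x + ?f a y" "?f a (c *\<^sub>C x) = c *\<^sub>C ?f a x" if "a \<in> Dexp" for a c
    using bounded[OF that] coord[of x] coord[of y]
    by (simp_all add: coord_lift_map plus_ell2.rep_eq cscale.rep_eq bounded_op_def
        flip: coord_inject)
  have "0 \<le> (\<Sum>i<2. \<Sum>j<2. \<Sum>a\<in>Dexp. toeplitz_generator a i j * \<langle>?f a (h j), h i\<rangle>)" for h
    using assms S1_pos_toeplitz_generator by (simp add: cp_S1_iff bounded)
  from this[of "\<lambda>i. if i = 0 then x else y"]
  show "0 \<le> \<langle>?f 0 x, x\<rangle> + \<langle>?f 0 y, y\<rangle> + \<langle>?f 1 y, x\<rangle> + \<langle>?f (- 1) x, y\<rangle>"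
    by (simp add: numeral_2_eq_2 Dexp_def toeplitz_generator_def add_ac)
  obtain C where C: "\<And>f. f \<in> l2 \<Longrightarrow> l2norm (\<Phi> 0 f) \<le> C * l2norm f"
    using bounded[OF Dexp_mem(1)] unfolding bounded_op_def by blast
  have "Re \<langle>?f 0 z, z\<rangle> \<le> C * (norm z)\<^sup>2" for z
  proof -
    have bound: "norm (?f 0 z) \<le> C * norm z"
      using C[OF coord, of z] by (simp add: norm_eq_l2norm coord_lift_map bounded)
    have "Re \<langle>?f 0 z, z\<rangle> \<le> norm (?f 0 z) * norm z"
      using complex_Re_le_cmod norm_cinner_le by (rule order_trans)
    also have "\<dots> \<le> (C * norm z) * norm z"
      using bound by (rule mult_right_mono) simp
    finally show ?thesis by (simp add: power2_eq_square mult.assoc)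
  qed
  then show "\<exists>C. \<forall>z. Re \<langle>?f 0 z, z\<rangle> \<le> C * (norm z)\<^sup>2" by blast
qed

lemma product_op_psd_iff:
  assumes "\<And>a. a \<in> Dexp \<Longrightarrow> bounded_op (\<Phi> a)" "\<And>b. b \<in> Dexp \<Longrightarrow> bounded_op (\<Psi> b)"
  shows "op_psd n (\<lambda>r s f t. \<Sum>a\<in>Dexp. \<Sum>b\<in>Dexp. X a b r s * \<Phi> a (\<Psi> b f) t) \<longleftrightarrow>
    (\<forall>h. 0 \<le> (\<Sum>r<n. \<Sum>s<n. \<Sum>a\<in>Dexp. \<Sum>b\<in>Dexp.
      X a b r s * \<langle>lift_map (\<Phi> a) (lift_map (\<Psi> b) (h s)), h r\<rangle>))"
proof -
  have "op_psd n (\<lambda>r s f t. \<Sum>a\<in>Dexp. \<Sum>b\<in>Dexp. X a b r s * \<Phi> a (\<Psi> b f) t) \<longleftrightarrow>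
      (\<forall>h. 0 \<le> (\<Sum>r<n. \<Sum>s<n. \<langle>\<Sum>a\<in>Dexp. \<Sum>b\<in>Dexp.
        X a b r s *\<^sub>C lift_map (\<Phi> a) (lift_map (\<Psi> b) (h s)), h r\<rangle>))"
    by (rule op_psd_iff_cinner) (simp add: fun_eq_iff coord_sum cscale.rep_eq coord_lift_map assms)
  then show ?thesis by (simp add: cinner.sum_left)
qed

proposition min_pos_imp_comm_pos:
  assumes X: "min_pos n X"
  shows "comm_pos TYPE('i) n X"
  unfolding comm_pos_def
proof (intro allI impI)
  fix \<Phi> \<Psi> :: "int \<Rightarrow> ('i \<Rightarrow> complex) \<Rightarrow> ('i \<Rightarrow> complex)"
  assume cp: "cp_S1 \<Phi>" "cp_S1 \<Psi>" and comm: "commuting_ranges \<Phi> \<Psi>"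
  have bounded: "bounded_op (\<Phi> a)" "bounded_op (\<Psi> a)" if "a \<in> Dexp" for a
    using cp that by (auto simp: cp_S1_def)
  have "lift_map (\<Phi> a) (lift_map (\<Psi> b) x) = lift_map (\<Psi> b) (lift_map (\<Phi> a) x)"
    if "a \<in> Dexp" "b \<in> Dexp" for a b x
    using comm that coord[of x]
    by (simp add: commuting_ranges_def coord_lift_map bounded flip: coord_inject)
  then show "op_psd n (\<lambda>r s f t. \<Sum>a\<in>Dexp. \<Sum>b\<in>Dexp. X a b r s * \<Phi> a (\<Psi> b f) t)"
    using cp X
    by (intro product_op_psd_iff[THEN iffD2] allI commuting_toeplitz_maps_nonneg
        toeplitz_map_lift_map bounded)
qed

lemma bounded_op_scalar: "bounded_op (\<lambda>(f :: 'i \<Rightarrow> complex) t. c * f t)"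
proof -
  have "l2norm (\<lambda>t. c * f t) \<le> cmod c * l2norm f" if "f \<in> l2" for f :: "'i \<Rightarrow> complex"
    using norm_cscale[of c "Abs_ell2 f"] that
    by (simp add: norm_eq_l2norm cscale.rep_eq Abs_ell2_inverse)
  then show ?thesis
    unfolding bounded_op_def by (auto simp: l2_scale distrib_left mult.left_commute)
qed

lemma lift_map_scalar: "lift_map (\<lambda>f t. c * f t) x = c *\<^sub>C x"
  by (simp add: coord_lift_map bounded_op_scalar cscale.rep_eq flip: coord_inject)

lemma cp_S1_scalar:
  assumes z: "cmod z = 1"
  shows "cp_S1 (\<lambda>a (f :: 'i \<Rightarrow> complex) t. z powi a * f t)"
  unfolding cp_S1_iff[OF bounded_op_scalar]
proof (intro allI impI)
  fix k P and h :: "nat \<Rightarrow> 'i ell2"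
  assume "S1_pos k P"
  then have "tensor_nonneg k (\<lambda>i j. \<Sum>a\<in>Dexp. P a i j * z powi a) (1 :: 'i ell2_op)"
    using z by (intro tensor_nonneg_one) (simp add: S1_pos_def)
  then have "0 \<le> (\<Sum>i<k. \<Sum>j<k. (\<Sum>a\<in>Dexp. P a i j * z powi a) * \<langle>1 \<cdot> h j, h i\<rangle>)"
    unfolding tensor_nonneg_def by blast
  then show "0 \<le> (\<Sum>i<k. \<Sum>j<k. \<Sum>a\<in>Dexp. P a i j * \<langle>lift_map (\<lambda>f t. z powi a * f t) (h j), h i\<rangle>)"
    by (simp add: lift_map_scalar sum_distrib_right mult.assoc)
qed

proposition comm_pos_imp_min_pos:
  assumes "comm_pos TYPE('i) n X"
  shows "min_pos n X"
  unfolding min_pos_iff_torus_eval psd_def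
proof (intro allI impI)
  fix z w :: complex and v :: "nat \<Rightarrow> complex"
  assume z: "cmod z = 1" and w: "cmod w = 1"
  obtain e :: "'i ell2" where e: "e \<noteq> 0" using ex_nonzero_ell2 by blast
  have "commuting_ranges (\<lambda>a (f :: 'i \<Rightarrow> complex) t. z powi a * f t) (\<lambda>b f t. w powi b * f t)"
    by (simp add: commuting_ranges_def mult.left_commute)
  then have "op_psd n (\<lambda>r s (f :: 'i \<Rightarrow> complex) t. \<Sum>a\<in>Dexp. \<Sum>b\<in>Dexp.
      X a b r s * (z powi a * (w powi b * f t)))"
    using assms cp_S1_scalar[OF z] cp_S1_scalar[OF w] unfolding comm_pos_def by blast
  then have "\<forall>h :: nat \<Rightarrow> 'i ell2. 0 \<le> (\<Sum>r<n. \<Sum>s<n. \<Sum>a\<in>Dexp. \<Sum>b\<in>Dexp.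
      X a b r s * \<langle>z powi a *\<^sub>C w powi b *\<^sub>C h s, h r\<rangle>)"
    unfolding product_op_psd_iff[OF bounded_op_scalar bounded_op_scalar] lift_map_scalar .
  then have "0 \<le> (\<Sum>r<n. \<Sum>s<n. \<Sum>a\<in>Dexp. \<Sum>b\<in>Dexp.
      X a b r s * \<langle>z powi a *\<^sub>C w powi b *\<^sub>C v s *\<^sub>C e, v r *\<^sub>C e\<rangle>)"
    by (rule spec)
  also have "\<dots> = (\<Sum>i<n. \<Sum>j<n. cnj (v i) * torus_eval X z w i j * v j)
      * complex_of_real ((norm e)\<^sup>2)"
    by (simp add: torus_eval_def cinner_self_norm sum_distrib_left sum_distrib_right mult_ac)
  finally show "0 \<le> (\<Sum>i<n. \<Sum>j<n. cnj (v i) * torus_eval X z w i j * v j)"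
    using e by (simp add: less_eq_complex_def zero_le_mult_iff flip: of_real_power)
qed

section \<open>Positivity of the identity map\<close>

definition add_unit :: "real \<Rightarrow> (int \<Rightarrow> int \<Rightarrow> cmat) \<Rightarrow> int \<Rightarrow> int \<Rightarrow> cmat" where
  "add_unit e X a b r s = X a b r s + (if a = 0 \<and> b = 0 \<and> r = s then complex_of_real e else 0)"

lemma max_pos_iff_add_unit: "max_pos n X \<longleftrightarrow> (\<forall>e>0. max_D n (add_unit e X))"
  by (simp add: max_pos_def add_unit_def[abs_def])

lemma torus_eval_add_unit_form:
  "(\<Sum>i<n. \<Sum>j<n. cnj (v i) * torus_eval (add_unit e X) z w i j * v j)
    = (\<Sum>i<n. \<Sum>j<n. cnj (v i) * torus_eval X z w i j * v j)
      + complex_of_real (e * (\<Sum>i<n. (cmod (v i))\<^sup>2))"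
proof -
  have "torus_eval (add_unit e X) z w i j
      = torus_eval X z w i j + (if i = j then complex_of_real e else 0)" for i j
    by (simp add: torus_eval_def add_unit_def Dexp_def algebra_simps)
  moreover have "(\<Sum>j<n. cnj (v i) * (if i = j then complex_of_real e else 0) * v j)
      = complex_of_real (e * (cmod (v i))\<^sup>2)" if "i < n" for i
  proof -
    have "(\<Sum>j<n. cnj (v i) * (if i = j then complex_of_real e else 0) * v j)
        = (\<Sum>j<n. if i = j then complex_of_real e * (v i * cnj (v i)) else 0)"
      by (intro sum.cong refl) auto
    then show ?thesis using that by (simp flip: complex_norm_square)
  qed
  ultimately show ?thesis
    by (simp add: distrib_left distrib_right sum.distrib sum_distrib_left)
qed

lemma min_pos_add_unit:
  assumes "min_pos n X" "0 \<le> e"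
  shows "min_pos n (add_unit e X)"
  unfolding min_pos_iff_torus_eval psd_def torus_eval_add_unit_form
proof (intro allI impI add_nonneg_nonneg)
  show "0 \<le> (\<Sum>i<n. \<Sum>j<n. cnj (v i) * torus_eval X z w i j * v j)"
    if "cmod z = 1" "cmod w = 1" for z w v
    using assms that by (simp add: min_pos_iff_torus_eval psd_def)
  show "0 \<le> complex_of_real (e * (\<Sum>i<n. (cmod (v i))\<^sup>2))" for v
    using assms by (simp add: less_eq_complex_def sum_nonneg)
qed

lemma toeplitz_form_nonneg_of_trigonometric:
  fixes x0 x1 xm :: complex
  assumes trig: "\<And>w. cmod w = 1 \<Longrightarrow> 0 \<le> x0 + x1 * w + xm * cnj w"
  shows "0 \<le> x0 / 2 * (p * cnj p + q * cnj q) + x1 * (cnj p * q) + xm * (cnj q * p)"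
proof -
  have x0_nonneg: "0 \<le> x0"
    using trig[of 1] trig[of "-1"] by (auto simp: less_eq_complex_def)
  define u where "u = cnj p * q"
  define w where "w = (if u = 0 then 1 else sgn u)"
  have norm_w: "cmod w = 1" by (simp add: w_def norm_sgn)
  have polar: "of_real (cmod u) * w = u"
    by (auto simp: w_def sgn_div_norm scaleR_conv_of_real field_simps)
  have polar_cnj: "of_real (cmod u) * cnj w = cnj u"
    using arg_cong[OF polar, of cnj] by simp
  have norm_u: "cmod u = cmod p * cmod q" by (simp add: u_def norm_mult)
  have "0 \<le> of_real (cmod u) * (x0 + x1 * w + xm * cnj w) + x0 / 2 * of_real ((cmod p - cmod q)\<^sup>2)"
    using x0_nonneg
    by (intro add_nonneg_nonneg mult_nonneg_nonneg trig norm_w) (auto simp: less_eq_complex_def)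
  also have "\<dots> = x0 / 2 * of_real ((cmod p - cmod q)\<^sup>2 + 2 * cmod u)
      + x1 * (of_real (cmod u) * w) + xm * (of_real (cmod u) * cnj w)"
    by (simp add: algebra_simps)
  also have "\<dots> = x0 / 2 * of_real ((cmod p)\<^sup>2 + (cmod q)\<^sup>2) + x1 * u + xm * cnj u"
    unfolding polar polar_cnj by (simp add: norm_u power2_diff)
  also have "\<dots> = x0 / 2 * (p * cnj p + q * cnj q) + x1 * (cnj p * q) + xm * (cnj q * p)"
    unfolding u_def of_real_add complex_norm_square by (simp add: mult.commute)
  finally show ?thesis .
qed

lemma min_pos_1_imp_max_D:
  assumes X: "min_pos 1 X"
  shows "max_D 1 X"
proof -
  define P :: "int \<Rightarrow> cmat" where "P a i j = (if i = j then X a 0 0 0 / 2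
      else if i = 0 then X a 1 0 0 else X a (-1) 0 0)" for a i j
  define A :: cmat where "A l r = (if l = 0 \<or> l = 3 then 1 else 0)" for l r
  have "S1_pos 2 P"
    unfolding S1_pos_def psd_def
  proof (intro allI impI)
    fix z :: complex and v :: "nat \<Rightarrow> complex"
    assume z: "cmod z = 1"
    define x where "x b = (\<Sum>a\<in>Dexp. X a b 0 0 * z powi a)" for b
    have "0 \<le> x 0 + x 1 * w + x (-1) * cnj w" if w: "cmod w = 1" for w
    proof -
      have "psd 1 (torus_eval X z w)"
        using X z w by (simp add: min_pos_iff_torus_eval)
      from this[unfolded psd_def, THEN spec, of "\<lambda>_. 1"] have "0 \<le> torus_eval X z w 0 0"
        by simp
      also have "\<dots> = x 0 + x 1 * w + x (-1) * cnj w"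
        by (simp add: torus_eval_def x_def Dexp_def cnj_eq_inverse[OF w] algebra_simps)
      finally show ?thesis .
    qed
    from toeplitz_form_nonneg_of_trigonometric[OF this, of "v 0" "v 1"]
    show "0 \<le> (\<Sum>i<2. \<Sum>j<2. cnj (v i) * (\<Sum>a\<in>Dexp. P a i j * z powi a) * v j)"
      by (simp add: numeral_2_eq_2 P_def x_def Dexp_def add_divide_distrib algebra_simps)
  qed
  moreover have "X a b r s = (\<Sum>i<2. \<Sum>j<2. \<Sum>p<2. \<Sum>q<2.
      cnj (A (i*2+p) r) * (P a i j * toeplitz_generator b p q) * A (j*2+q) s)"
    if "b \<in> Dexp" "r < 1" "s < 1" for a b r s
    using that by (auto simp: numeral_2_eq_2 A_def P_def toeplitz_generator_def elim: Dexp_cases)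
  ultimately show ?thesis
    unfolding max_D_def using S1_pos_toeplitz_generator by blast
qed

proposition min_pos_1_imp_max_pos: "min_pos 1 X \<Longrightarrow> max_pos 1 X"
  unfolding max_pos_iff_add_unit by (metis less_imp_le min_pos_1_imp_max_D min_pos_add_unit)

section \<open>Functionals nonnegative on the maximal cone\<close>

lemma sum_Times: "(\<Sum>p\<in>S \<times> I. f p) = (\<Sum>i\<in>S. \<Sum>u\<in>I. f (i, u))"
  unfolding sum.cartesian_product by simp

lemma sum_Times_Times:
  "(\<Sum>p\<in>S \<times> I. \<Sum>q\<in>T \<times> J. f p q) = (\<Sum>i\<in>S. \<Sum>j\<in>T. \<Sum>u\<in>I. \<Sum>v\<in>J. f (i, u) (j, v))"
proof -
  have "(\<Sum>p\<in>S \<times> I. \<Sum>q\<in>T \<times> J. f p q) = (\<Sum>i\<in>S. \<Sum>u\<in>I. \<Sum>j\<in>T. \<Sum>v\<in>J. f (i, u) (j, v))"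
    by (simp only: sum_Times)
  also have "\<dots> = (\<Sum>i\<in>S. \<Sum>j\<in>T. \<Sum>u\<in>I. \<Sum>v\<in>J. f (i, u) (j, v))"
    by (intro sum.cong refl sum.swap)
  finally show ?thesis .
qed

lemma psd_on_reindex:
  assumes inj: "inj_on \<phi> J" and K: "psd_on (\<phi> ` J) K"
  shows "psd_on J (\<lambda>i j. K (\<phi> i) (\<phi> j))"
  unfolding psd_on_def
proof
  fix v :: "'a \<Rightarrow> complex"
  let ?v = "\<lambda>i. v (inv_into J \<phi> i)"
  have "0 \<le> (\<Sum>i\<in>\<phi> ` J. \<Sum>j\<in>\<phi> ` J. cnj (?v i) * K i j * ?v j)"
    using K unfolding psd_on_def by (rule spec)
  then show "0 \<le> (\<Sum>i\<in>J. \<Sum>j\<in>J. cnj (v i) * K (\<phi> i) (\<phi> j) * v j)"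
    using inj by (simp add: sum.reindex)
qed

lift_definition matrix_map :: "'i set \<Rightarrow> ('i \<Rightarrow> 'i \<Rightarrow> complex) \<Rightarrow> 'i ell2 \<Rightarrow> 'i ell2" is
  "\<lambda>I M x i. if i \<in> I then \<Sum>j\<in>I. M i j * x j else 0"
proof -
  show "(\<lambda>i. if i \<in> I then \<Sum>j\<in>I. M i j * x j else 0) \<in> l2" for I M and x :: "'i \<Rightarrow> complex"
  proof (cases "finite I")
    case False
    then show ?thesis using l2_zero by (simp add: if_distrib cong: if_cong)
  qed (rule l2_finite_support)
qed

lemma cinner_matrix_map:
  assumes "finite I"
  shows "\<langle>matrix_map I M x, y\<rangle> = (\<Sum>i\<in>I. \<Sum>j\<in>I. cnj (coord y i) * M i j * coord x j)"
proof -
  have "\<langle>matrix_map I M x, y\<rangle> = (\<Sum>\<^sub>\<infinity>i\<in>I. (\<Sum>j\<in>I. M i j * coord x j) * cnj (coord y i))"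
    unfolding cinner.rep_eq l2inner_def matrix_map.rep_eq by (rule infsum_cong_neutral) auto
  then show ?thesis
    using assms by (simp add: sum_distrib_left sum_distrib_right mult_ac)
qed

lemma norm_coord_le: "cmod (coord x i) \<le> norm x"
proof -
  have "(cmod (coord x i))\<^sup>2 = (\<Sum>\<^sub>\<infinity>i\<in>{i}. (cmod (coord x i))\<^sup>2)" by simp
  also have "\<dots> \<le> (\<Sum>\<^sub>\<infinity>i. (cmod (coord x i))\<^sup>2)"
    using coord[of x] by (intro infsum_mono2) (auto simp: l2_iff_summable)
  also have "\<dots> = (norm x)\<^sup>2"
    by (simp add: norm_eq_l2norm l2norm_def infsum_nonneg)
  finally show ?thesis by (rule power2_le_imp_le) simp
qed

lemma toeplitz_map_matrix_map:
  assumes I: "finite I"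
    and M: "psd_on ({..<2} \<times> I) (\<lambda>(i, u) (j, v). M (int j - int i) u v)"
  shows "toeplitz_map (\<lambda>a. matrix_map I (M a))"
proof
  fix a c and x y :: "'a ell2"
  show "matrix_map I (M a) (x + y) = matrix_map I (M a) x + matrix_map I (M a) y"
    by (rule cinner_ext)
       (simp add: cinner.add_left cinner_matrix_map[OF I] plus_ell2.rep_eq distrib_left sum.distrib)
  show "matrix_map I (M a) (c *\<^sub>C x) = c *\<^sub>C matrix_map I (M a) x"
    by (rule cinner_ext) (simp add: cinner_matrix_map[OF I] cscale.rep_eq sum_distrib_left mult_ac)
  show "0 \<le> \<langle>matrix_map I (M 0) x, x\<rangle> + \<langle>matrix_map I (M 0) y, y\<rangle>
      + \<langle>matrix_map I (M 1) y, x\<rangle> + \<langle>matrix_map I (M (- 1)) x, y\<rangle>"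
    using M[unfolded psd_on_def, THEN spec, of "\<lambda>(i, u). if i = 0 then coord x u else coord y u"]
    unfolding sum_Times_Times by (simp add: cinner_matrix_map[OF I] numeral_2_eq_2 add_ac)
next
  have "Re \<langle>matrix_map I (M 0) x, x\<rangle> \<le> (\<Sum>i\<in>I. \<Sum>j\<in>I. cmod (M 0 i j)) * (norm x)\<^sup>2" for x
  proof -
    have "Re \<langle>matrix_map I (M 0) x, x\<rangle> \<le> cmod \<langle>matrix_map I (M 0) x, x\<rangle>"
      by (rule complex_Re_le_cmod)
    also have "\<dots> \<le> (\<Sum>i\<in>I. \<Sum>j\<in>I. norm x * cmod (M 0 i j) * norm x)"
      unfolding cinner_matrix_map[OF I]
      by (intro sum_norm_le) (auto simp: norm_mult norm_coord_le intro!: mult_mono)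
    also have "\<dots> = (\<Sum>i\<in>I. \<Sum>j\<in>I. cmod (M 0 i j)) * (norm x)\<^sup>2"
      by (simp add: sum_distrib_left power2_eq_square mult_ac)
    finally show ?thesis .
  qed
  then show "\<exists>C. \<forall>x. Re \<langle>matrix_map I (M 0) x, x\<rangle> \<le> C * (norm x)\<^sup>2" by blast
qed

lemma psd_on_S1_pos_toeplitz_kernel:
  assumes I: "finite I"
    and M: "psd_on ({..<2} \<times> I) (\<lambda>(i, u) (j, v). M (int j - int i) u v)"
    and P: "S1_pos k P"
  shows "psd_on ({..<k} \<times> I) (\<lambda>(i, u) (j, v). \<Sum>a\<in>Dexp. P a i j * M a u v)"
  unfolding psd_on_def
proof
  fix v :: "nat \<times> 'a \<Rightarrow> complex"
  define h where "h i = Abs_ell2 (\<lambda>u. if u \<in> I then v (i, u) else 0)" for i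
  have coord_h: "coord (h i) u = v (i, u)" if "u \<in> I" for i u
    using that I by (simp add: h_def Abs_ell2_inverse l2_finite_support)
  have "0 \<le> (\<Sum>i<k. \<Sum>j<k. \<Sum>a\<in>Dexp. P a i j * \<langle>matrix_map I (M a) (h j), h i\<rangle>)"
    using I M P by (intro toeplitz_map_nonneg toeplitz_map_matrix_map)
  also have "\<dots> = (\<Sum>i<k. \<Sum>j<k. \<Sum>u\<in>I. \<Sum>w\<in>I.
      cnj (v (i, u)) * (\<Sum>a\<in>Dexp. P a i j * M a u w) * v (j, w))"
    by (simp add: cinner_matrix_map[OF I] coord_h Dexp_def sum_distrib_left sum.distrib algebra_simps)
  finally show "0 \<le> (\<Sum>p\<in>{..<k} \<times> I. \<Sum>q\<in>{..<k} \<times> I. cnj (v p)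
      * (case p of (i, u) \<Rightarrow> \<lambda>(j, w). \<Sum>a\<in>Dexp. P a i j * M a u w) q * v q)"
    unfolding sum_Times_Times by simp
qed

definition pairing :: "nat \<Rightarrow> (int \<Rightarrow> int \<Rightarrow> cmat) \<Rightarrow> (int \<Rightarrow> int \<Rightarrow> cmat) \<Rightarrow> complex" where
  "pairing n T X = (\<Sum>a\<in>Dexp. \<Sum>b\<in>Dexp. \<Sum>r<n. \<Sum>s<n. T a b r s * X a b r s)"

lemma pairing_add_unit:
  "pairing n T (add_unit e X) = pairing n T X + of_real e * (\<Sum>r<n. T 0 0 r r)"
proof -
  have "(\<Sum>s<n. T 0 0 r s * (if r = s then of_real e else 0)) = of_real e * T 0 0 r r"
    if "r < n" for r
  proof -
    have "(\<Sum>s<n. T 0 0 r s * (if r = s then of_real e else 0))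
        = (\<Sum>s<n. if r = s then of_real e * T 0 0 r s else 0)"
      by (intro sum.cong refl) auto
    then show ?thesis using that by simp
  qed
  then have "(\<Sum>r<n. \<Sum>s<n. T 0 0 r s * (if r = s then of_real e else 0))
      = of_real e * (\<Sum>r<n. T 0 0 r r)"
    by (simp add: sum_distrib_left)
  then show ?thesis
    by (simp add: pairing_def add_unit_def Dexp_def distrib_left sum.distrib)
qed

lemma sum_rotate_8:
  "(\<Sum>p\<in>S1. \<Sum>q\<in>S2. \<Sum>i\<in>S3. \<Sum>j\<in>S4. \<Sum>r\<in>S5. \<Sum>s\<in>S6. \<Sum>b\<in>S7. \<Sum>a\<in>S8. g p q i j r s b a)
  = (\<Sum>a\<in>S8. \<Sum>b\<in>S7. \<Sum>r\<in>S5. \<Sum>s\<in>S6. \<Sum>i\<in>S3. \<Sum>j\<in>S4. \<Sum>p\<in>S1. \<Sum>q\<in>S2. g p q i j r s b a)"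
  unfolding sum.cartesian_product
  by (rule sum.reindex_bij_witness[where i = "\<lambda>(a,b,r,s,i,j,p,q). (p,q,i,j,r,s,b,a)"
      and j = "\<lambda>(p,q,i,j,r,s,b,a). (a,b,r,s,i,j,p,q)"]) auto

lemma psd_on_S1_pos_S1_pos_kernel:
  fixes T :: "int \<Rightarrow> int \<Rightarrow> cmat"
  assumes T: "psd_on ({..<2} \<times> {..<2} \<times> {..<n})
      (\<lambda>(i, p, r) (j, q, s). T (int j - int i) (int q - int p) r s)"
    and P: "S1_pos k P" and Q: "S1_pos m Q"
  shows "psd_on ({..<m} \<times> {..<k} \<times> {..<n})
    (\<lambda>(p, i, r) (q, j, s). \<Sum>b\<in>Dexp. Q b p q * (\<Sum>a\<in>Dexp. P a i j * T a b r s))"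
proof -
  let ?TQ = "\<lambda>a (p, r) (q, s). T a (int q - int p) r s"
  let ?TP = "\<lambda>b (i, r) (j, s). \<Sum>a\<in>Dexp. P a i j * T a b r s"
  let ?swap = "\<lambda>(p :: nat, i :: nat, r :: nat). (i, p, r)"
  have swap: "?swap ` ({..<2} \<times> {..<k} \<times> {..<n}) = {..<k} \<times> {..<2} \<times> {..<n}"
    by force
  have "psd_on ({..<2} \<times> {..<2} \<times> {..<n}) (\<lambda>(i, u) (j, v). ?TQ (int j - int i) u v)"
    using T by (simp only: case_prod_unfold)
  then have "psd_on (?swap ` ({..<2} \<times> {..<k} \<times> {..<n}))
      (\<lambda>(i, u) (j, v). \<Sum>a\<in>Dexp. P a i j * ?TQ a u v)"
    unfolding swap by (rule psd_on_S1_pos_toeplitz_kernel[rotated]) (rule P, simp)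
  then have "psd_on ({..<2} \<times> {..<k} \<times> {..<n})
      (\<lambda>x y. (\<lambda>(i, u) (j, v). \<Sum>a\<in>Dexp. P a i j * ?TQ a u v) (?swap x) (?swap y))"
    by (rule psd_on_reindex[rotated]) (auto simp: inj_on_def)
  then have "psd_on ({..<2} \<times> {..<k} \<times> {..<n}) (\<lambda>(p, u) (q, v). ?TP (int q - int p) u v)"
    by (simp only: case_prod_unfold fst_conv snd_conv)
  then have "psd_on ({..<m} \<times> {..<k} \<times> {..<n}) (\<lambda>(p, u) (q, v). \<Sum>b\<in>Dexp. Q b p q * ?TP b u v)"
    by (rule psd_on_S1_pos_toeplitz_kernel[rotated]) (rule Q, simp)
  then show ?thesis by (simp only: case_prod_unfold)
qed

proposition pairing_nonneg_of_max_D: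
  assumes T: "psd_on ({..<2} \<times> {..<2} \<times> {..<n})
      (\<lambda>(i, p, r) (j, q, s). T (int j - int i) (int q - int p) r s)"
    and X: "max_D n X"
  shows "0 \<le> pairing n T X"
proof -
  obtain k m P Q A where P: "S1_pos k P" and Q: "S1_pos m Q"
    and X: "\<forall>a\<in>Dexp. \<forall>b\<in>Dexp. \<forall>r<n. \<forall>s<n. X a b r s = (\<Sum>i<k. \<Sum>j<k. \<Sum>p<m. \<Sum>q<m.
      cnj (A (i*m+p) r) * (P a i j * Q b p q) * A (j*m+q) s)"
    using X unfolding max_D_def by blast
  from psd_on_S1_pos_S1_pos_kernel[OF T P Q, unfolded psd_on_def, THEN spec,
      of "\<lambda>(p, i, r). A (i*m+p) r"]
  have "0 \<le> (\<Sum>p<m. \<Sum>q<m. \<Sum>i<k. \<Sum>j<k. \<Sum>r<n. \<Sum>s<n. cnj (A (i*m+p) r)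
      * (\<Sum>b\<in>Dexp. Q b p q * (\<Sum>a\<in>Dexp. P a i j * T a b r s)) * A (j*m+q) s)"
    unfolding sum_Times_Times by simp
  also have "\<dots> = (\<Sum>p<m. \<Sum>q<m. \<Sum>i<k. \<Sum>j<k. \<Sum>r<n. \<Sum>s<n. \<Sum>b\<in>Dexp. \<Sum>a\<in>Dexp.
      T a b r s * (cnj (A (i*m+p) r) * (P a i j * Q b p q) * A (j*m+q) s))"
    by (simp add: sum_distrib_left sum_distrib_right mult_ac)
  also have "\<dots> = (\<Sum>a\<in>Dexp. \<Sum>b\<in>Dexp. \<Sum>r<n. \<Sum>s<n. \<Sum>i<k. \<Sum>j<k. \<Sum>p<m. \<Sum>q<m.
      T a b r s * (cnj (A (i*m+p) r) * (P a i j * Q b p q) * A (j*m+q) s))"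
    by (rule sum_rotate_8)
  also have "\<dots> = pairing n T X"
    unfolding pairing_def using X by (intro sum.cong refl) (simp add: sum_distrib_left)
  finally show ?thesis .
qed

section \<open>The Shifts unextendible product basis\<close>

lemma orthogonal_projection_idempotent:
  fixes \<phi> :: "'k \<Rightarrow> 'i \<Rightarrow> complex" and c :: "'k \<Rightarrow> real"
  assumes "finite L" and c: "\<And>k. k \<in> L \<Longrightarrow> c k \<noteq> 0"
    and orth: "\<And>k l. k \<in> L \<Longrightarrow> l \<in> L \<Longrightarrow>
      (\<Sum>i\<in>I. \<phi> k i * cnj (\<phi> l i)) = (if k = l then of_real (c k) else 0)"
  defines "P \<equiv> \<lambda>i j. \<Sum>k\<in>L. cnj (\<phi> k i) * \<phi> k j / of_real (c k)"
  shows "(\<Sum>x\<in>I. P i x * P x j) = P i j"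
proof -
  let ?d = "\<lambda>k l. cnj (\<phi> k i) * \<phi> l j / (of_real (c k) * of_real (c l))"
  have "(\<Sum>x\<in>I. P i x * P x j) = (\<Sum>x\<in>I. \<Sum>k\<in>L. \<Sum>l\<in>L. ?d k l * (\<phi> k x * cnj (\<phi> l x)))"
    by (simp add: P_def sum_product field_simps)
  also have "\<dots> = (\<Sum>k\<in>L. \<Sum>x\<in>I. \<Sum>l\<in>L. ?d k l * (\<phi> k x * cnj (\<phi> l x)))"
    by (rule sum.swap)
  also have "\<dots> = (\<Sum>k\<in>L. \<Sum>l\<in>L. ?d k l * (\<Sum>x\<in>I. \<phi> k x * cnj (\<phi> l x)))"
    unfolding sum_distrib_left by (intro sum.cong refl sum.swap)
  also have "\<dots> = (\<Sum>k\<in>L. \<Sum>l\<in>L. if k = l then cnj (\<phi> k i) * \<phi> k j / of_real (c k) else 0)"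
    by (intro sum.cong refl) (simp add: orth c)
  also have "\<dots> = P i j"
    using assms(1) by (simp add: P_def)
  finally show ?thesis .
qed

lemma psd_on_orthogonal_complement:
  fixes \<phi> :: "'k \<Rightarrow> 'i \<Rightarrow> complex" and c :: "'k \<Rightarrow> real"
  assumes I: "finite I" and L: "finite L" "\<And>k. k \<in> L \<Longrightarrow> c k \<noteq> 0"
    and orth: "\<And>k l. k \<in> L \<Longrightarrow> l \<in> L \<Longrightarrow>
      (\<Sum>i\<in>I. \<phi> k i * cnj (\<phi> l i)) = (if k = l then of_real (c k) else 0)"
  defines "P \<equiv> \<lambda>i j. \<Sum>k\<in>L. cnj (\<phi> k i) * \<phi> k j / of_real (c k)"
  shows "psd_on I (\<lambda>i j. (if i = j then 1 else 0) - P i j)"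
proof (rule psd_on_gram)
  fix i j assume i: "i \<in> I" and j: "j \<in> I"
  define \<delta> :: "'i \<Rightarrow> 'i \<Rightarrow> complex" where "\<delta> x y = (if x = y then 1 else 0)" for x y
  have cnj_\<delta>: "cnj (\<delta> x y) = \<delta> x y" for x y
    by (simp add: \<delta>_def)
  have cnj_P: "cnj (P x y) = P y x" for x y
    by (simp add: P_def mult.commute)
  have delta: "(\<Sum>x\<in>I. \<delta> x y * f x) = f y" "(\<Sum>x\<in>I. f x * \<delta> x y) = f y" if "y \<in> I" for y f
  proof -
    have "(\<Sum>x\<in>I. \<delta> x y * f x) = (\<Sum>x\<in>I. if x = y then f x else 0)"
      by (intro sum.cong refl) (simp add: \<delta>_def)
    then show "(\<Sum>x\<in>I. \<delta> x y * f x) = f y" using that I by simp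
    then show "(\<Sum>x\<in>I. f x * \<delta> x y) = f y" by (simp only: mult.commute)
  qed
  have "(\<Sum>x\<in>I. cnj (\<delta> x i - P x i) * (\<delta> x j - P x j))
      = (\<Sum>x\<in>I. \<delta> x i * \<delta> x j) - (\<Sum>x\<in>I. \<delta> x i * P x j)
        - (\<Sum>x\<in>I. P i x * \<delta> x j) + (\<Sum>x\<in>I. P i x * P x j)"
    by (simp add: cnj_P cnj_\<delta> algebra_simps sum.distrib sum_subtractf)
  also have "(\<Sum>x\<in>I. P i x * P x j) = P i j"
    unfolding P_def using L orth by (rule orthogonal_projection_idempotent)
  finally have "(\<Sum>x\<in>I. cnj (\<delta> x i - P x i) * (\<delta> x j - P x j)) = \<delta> i j - P i j"
    using i j by (simp add: delta)
  then show "(if i = j then 1 else 0) - P i j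
      = (\<Sum>x\<in>I. cnj ((if x = i then 1 else 0) - P x i) * ((if x = j then 1 else 0) - P x j))"
    unfolding \<delta>_def by (rule sym)
qed

text \<open>
  The qubits \<open>|0>, |1>, |+>, |->\<close> are realised by the vectors \<open>(1, z)\<close> with \<open>z = 1, -1, \<i>, -\<i>\<close> in the first
  two tensor factors, and the basis is \<open>|01+>, |1+0>, |+01>, |--->\<close>. Normalising the
  vectors would introduce square roots; \<open>upb_norm2\<close> lists their squared norms instead.\<close>

definition upb_z :: "nat \<Rightarrow> complex" where
  "upb_z k = [1, - 1, \<i>, - \<i>] ! k"

definition upb_w :: "nat \<Rightarrow> complex" where
  "upb_w k = [- 1, \<i>, 1, - \<i>] ! k"

definition upb_v :: "nat \<Rightarrow> nat \<Rightarrow> complex" where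
  "upb_v k r = (if r = 0 then [1, 1, 0, 1] else [1, 0, 1, - 1]) ! k"

definition upb_norm2 :: "nat \<Rightarrow> real" where
  "upb_norm2 k = [8, 4, 4, 8] ! k"

definition upb :: "nat \<Rightarrow> nat \<times> nat \<times> nat \<Rightarrow> complex" where
  "upb k = (\<lambda>(i, p, r). upb_z k ^ i * upb_w k ^ p * upb_v k r)"

definition upb_complement :: "int \<Rightarrow> int \<Rightarrow> cmat" where
  "upb_complement a b r s = (if a = 0 \<and> b = 0 \<and> r = s then 1 else 0)
    - (\<Sum>k<4. upb_z k powi a * upb_w k powi b * upb_v k r * upb_v k s / of_real (upb_norm2 k))"

lemma less_4_cases:
  assumes "k < (4 :: nat)"
  obtains "k = 0" | "k = 1" | "k = 2" | "k = 3"
  using assms by force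

lemma norm_upb_z: "k < 4 \<Longrightarrow> cmod (upb_z k) = 1"
  by (auto elim!: less_4_cases simp: upb_z_def)

lemma norm_upb_w: "k < 4 \<Longrightarrow> cmod (upb_w k) = 1"
  by (auto elim!: less_4_cases simp: upb_w_def)

lemma cnj_upb_v: "k < 4 \<Longrightarrow> cnj (upb_v k r) = upb_v k r"
  by (auto elim!: less_4_cases simp: upb_v_def)

lemma unimodular_powi_diff:
  assumes "cmod z = 1"
  shows "z powi (int j - int i) = cnj (z ^ i) * z ^ j"
proof -
  have "z \<noteq> 0" using assms by auto
  then show ?thesis
    using assms by (simp add: cnj_eq_inverse power_int_diff power_inverse divide_inverse)
qed

lemma upb_orthogonal:
  assumes "k < 4" "l < 4"
  shows "(\<Sum>u\<in>{..<2} \<times> {..<2} \<times> {..<2}. upb k u * cnj (upb l u))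
    = (if k = l then of_real (upb_norm2 k) else 0)"
  using assms unfolding sum_Times
  by (elim less_4_cases)
     (simp_all add: upb_def upb_z_def upb_w_def upb_v_def upb_norm2_def numeral_2_eq_2)

lemma psd_on_upb_complement:
  "psd_on ({..<2} \<times> {..<2} \<times> {..<2})
    (\<lambda>(i, p, r) (j, q, s). upb_complement (int j - int i) (int q - int p) r s)"
proof -
  let ?cube = "{..<2} \<times> {..<2} \<times> {..<2} :: (nat \<times> nat \<times> nat) set"
  let ?K = "\<lambda>u v. (if u = v then 1 else 0)
      - (\<Sum>k<4. cnj (upb k u) * upb k v / of_real (upb_norm2 k))"
  have "(\<lambda>(i, p, r) (j, q, s). upb_complement (int j - int i) (int q - int p) r s) = ?K"
  proof (intro ext)
    fix u v :: "nat \<times> nat \<times> nat"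
    obtain i p r j q s where uv: "u = (i, p, r)" "v = (j, q, s)" by (metis prod_cases3)
    have "upb_z k powi (int j - int i) * upb_w k powi (int q - int p) * upb_v k r * upb_v k s
        = cnj (upb k u) * upb k v" if "k < 4" for k
      using that
      by (simp add: uv upb_def unimodular_powi_diff norm_upb_z norm_upb_w cnj_upb_v mult_ac)
    then show "(case u of (i, p, r) \<Rightarrow>
        \<lambda>(j, q, s). upb_complement (int j - int i) (int q - int p) r s) v = ?K u v"
      by (auto simp: uv upb_complement_def)
  qed
  moreover have "psd_on ?cube ?K"
    by (rule psd_on_orthogonal_complement)
       (auto simp: upb_orthogonal upb_norm2_def elim!: less_4_cases)
  ultimately show ?thesis by (simp only:)
qed

text \<open>The Fourier coefficients of the function \<open>\<bar>z + \<zeta>\<bar>\<^sup>2\<close> on the circle.\<close>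

definition bump :: "complex \<Rightarrow> int \<Rightarrow> complex" where
  "bump \<zeta> a = (if a = 0 then 2 else \<zeta> powi (- a))"

lemma bump_eval:
  assumes "cmod \<zeta> = 1" "cmod z = 1"
  shows "(\<Sum>a\<in>Dexp. bump \<zeta> a * z powi a) = of_real ((cmod (z + \<zeta>))\<^sup>2)"
proof -
  have "z \<noteq> 0" "\<zeta> \<noteq> 0" using assms by auto
  then show ?thesis
    unfolding complex_norm_square using assms
    by (simp add: Dexp_def bump_def cnj_eq_inverse field_simps)
qed

definition upb_sum :: "int \<Rightarrow> int \<Rightarrow> cmat" where
  "upb_sum a b r s = (\<Sum>k<4. bump (upb_z k) a * bump (upb_w k) b * (upb_v k r * upb_v k s))"

lemma pairing_upb_complement_add_unit:
  "pairing 2 upb_complement (add_unit e X) = pairing 2 upb_complement X + of_real e"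
proof -
  have "(\<Sum>r<2. upb_complement 0 0 r r) = 1"
    by (simp add: upb_complement_def upb_v_def upb_norm2_def eval_nat_numeral)
  then show ?thesis by (simp add: pairing_add_unit)
qed

lemma pairing_upb_complement_upb_sum: "pairing 2 upb_complement upb_sum = 0"
  by (simp add: pairing_def Dexp_def upb_complement_def upb_sum_def bump_def
      upb_z_def upb_w_def upb_v_def upb_norm2_def eval_nat_numeral algebra_simps)

definition upb_gap :: "complex \<Rightarrow> complex \<Rightarrow> complex \<Rightarrow> complex \<Rightarrow> real" where
  "upb_gap z w p q =
    (\<Sum>k<4. (cmod ((z + upb_z k) * (w + upb_w k) * (upb_v k 0 * p + upb_v k 1 * q)))\<^sup>2)"

lemma torus_eval_upb_sum_form:
  assumes z: "cmod z = 1" and w: "cmod w = 1"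
  shows "(\<Sum>i<2. \<Sum>j<2. cnj (v i) * torus_eval upb_sum z w i j * v j)
    = of_real (upb_gap z w (v 0) (v 1))"
proof -
  let ?\<alpha> = "\<lambda>k. complex_of_real ((cmod (z + upb_z k))\<^sup>2)"
  let ?\<beta> = "\<lambda>k. complex_of_real ((cmod (w + upb_w k))\<^sup>2)"
  let ?u = "\<lambda>k. upb_v k 0 * v 0 + upb_v k 1 * v 1"
  have "torus_eval upb_sum z w r s = (\<Sum>k<4. (\<Sum>a\<in>Dexp. bump (upb_z k) a * z powi a)
      * (\<Sum>b\<in>Dexp. bump (upb_w k) b * w powi b) * (upb_v k r * upb_v k s))" for r s
    by (simp add: torus_eval_def upb_sum_def Dexp_def sum_distrib_left sum.distrib algebra_simps)
  then have "torus_eval upb_sum z w r s = (\<Sum>k<4. ?\<alpha> k * ?\<beta> k * (upb_v k r * upb_v k s))" for r s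
    using z w by (simp add: bump_eval norm_upb_z norm_upb_w)
  then have "(\<Sum>i<2. \<Sum>j<2. cnj (v i) * torus_eval upb_sum z w i j * v j)
      = (\<Sum>k<4. ?\<alpha> k * ?\<beta> k * (\<Sum>i<2. \<Sum>j<2. cnj (v i) * (upb_v k i * upb_v k j) * v j))"
    by (simp add: numeral_2_eq_2 sum_distrib_left sum.distrib algebra_simps)
  also have "\<dots> = (\<Sum>k<4. ?\<alpha> k * ?\<beta> k * of_real ((cmod (?u k))\<^sup>2))"
    unfolding complex_norm_square[of "?u _"]
    by (intro sum.cong refl) (simp add: numeral_2_eq_2 cnj_upb_v algebra_simps)
  also have "\<dots> = of_real (upb_gap z w (v 0) (v 1))"
    by (simp add: upb_gap_def norm_mult power_mult_distrib)
  finally show ?thesis .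
qed

text \<open>
  Each of the three tensor factors of a product vector is orthogonal to the corresponding factor of
  at most one of the four basis vectors.\<close>

lemma upb_unextendible:
  assumes "p \<noteq> 0 \<or> q \<noteq> 0"
  obtains k where "k < 4" "z \<noteq> - upb_z k" "w \<noteq> - upb_w k" "upb_v k 0 * p + upb_v k 1 * q \<noteq> 0"
proof -
  define Z where "Z = {k \<in> {..<4}. z = - upb_z k}"
  define W where "W = {k \<in> {..<4}. w = - upb_w k}"
  define V where "V = {k \<in> {..<4}. upb_v k 0 * p + upb_v k 1 * q = 0}"
  have "\<forall>k\<in>Z. \<forall>l\<in>Z. k = l" "\<forall>k\<in>W. \<forall>l\<in>W. k = l"
    by (auto simp: Z_def W_def upb_z_def upb_w_def complex_eq_iff elim!: less_4_cases)
  moreover have "\<forall>k\<in>V. \<forall>l\<in>V. k = l"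
    using assms by (auto simp: V_def upb_v_def elim!: less_4_cases)
  ultimately have "card Z \<le> 1" "card W \<le> 1" "card V \<le> 1"
    by (auto simp: Z_def W_def V_def card_le_Suc0_iff_eq)
  then have "card (Z \<union> W \<union> V) < card {..<4 :: nat}"
    using card_Un_le[of "Z \<union> W" V] card_Un_le[of Z W] by simp
  then have "\<not> {..<4} \<subseteq> Z \<union> W \<union> V"
    using card_mono[of "Z \<union> W \<union> V" "{..<4}"] by (auto simp: Z_def W_def V_def)
  then show thesis using that by (auto simp: Z_def W_def V_def)
qed

lemma upb_gap_pos:
  assumes "p \<noteq> 0 \<or> q \<noteq> 0"
  shows "0 < upb_gap z w p q"
proof -
  obtain k where "k < 4" "z \<noteq> - upb_z k" "w \<noteq> - upb_w k" "upb_v k 0 * p + upb_v k 1 * q \<noteq> 0"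
    using upb_unextendible[OF assms] by metis
  then show ?thesis
    unfolding upb_gap_def by (intro sum_pos2[of _ k]) (auto simp: eq_neg_iff_add_eq_0)
qed

lemma upb_gap_scale: "upb_gap z w (of_real c * p) (of_real c * q) = c\<^sup>2 * upb_gap z w p q"
proof -
  have "a * (s * (of_real c * p) + t * (of_real c * q)) = of_real c * (a * (s * p + t * q))"
    for a s t
    by (simp add: algebra_simps)
  then show ?thesis
    by (simp only: upb_gap_def norm_mult[of "of_real c"] power_mult_distrib norm_of_real power2_abs
        sum_distrib_left)
qed

lemma upb_gap_lower_bound:
  obtains e where "e > 0" "\<And>z w p q. cmod z = 1 \<Longrightarrow> cmod w = 1 \<Longrightarrow>
    e * ((cmod p)\<^sup>2 + (cmod q)\<^sup>2) \<le> upb_gap z w p q"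
proof -
  let ?S = "sphere (0 :: complex) 1 \<times> sphere (0 :: complex) 1 \<times> sphere (0 :: complex \<times> complex) 1"
  let ?gap = "\<lambda>(z, w, p, q). upb_gap z w p q"
  have "compact ?S" by (intro compact_Times compact_sphere)
  moreover have "(1, 1, 1, 0) \<in> ?S" by (simp add: norm_prod_def)
  then have "?S \<noteq> {}" by blast
  moreover have "continuous_on ?S ?gap"
    unfolding upb_gap_def case_prod_unfold by (intro continuous_intros)
  ultimately obtain x where minimum: "x \<in> ?S" "\<And>y. y \<in> ?S \<Longrightarrow> ?gap x \<le> ?gap y"
    using continuous_attains_inf[of ?S ?gap] by blast
  obtain z0 w0 p0 q0 where x_eq: "x = (z0, w0, p0, q0)" by (metis prod_cases4)
  have "0 < ?gap x"
    using minimum(1) by (auto simp: x_eq norm_prod_def intro!: upb_gap_pos)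
  moreover have "?gap x * ((cmod p)\<^sup>2 + (cmod q)\<^sup>2) \<le> upb_gap z w p q"
    if zw: "cmod z = 1" "cmod w = 1" for z w p q
  proof (cases "p = 0 \<and> q = 0")
    case False
    define c where "c = norm (p, q)"
    have c_pos: "c > 0" using False by (simp add: c_def zero_prod_def)
    have "norm (inverse c *\<^sub>R (p, q)) = 1"
      using c_pos unfolding norm_scaleR c_def[symmetric] by simp
    then have "(z, w, of_real (inverse c) * p, of_real (inverse c) * q) \<in> ?S"
      using zw by (simp add: scaleR_conv_of_real scaleR_prod_def)
    from minimum(2)[OF this] have "?gap x \<le> (inverse c)\<^sup>2 * upb_gap z w p q"
      by (simp only: prod.case upb_gap_scale)
    then have "?gap x * c\<^sup>2 \<le> upb_gap z w p q"
      using c_pos by (simp add: field_simps)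
    then show ?thesis by (simp add: c_def norm_prod_def)
  qed (simp add: upb_gap_def)
  ultimately show thesis by (rule that)
qed

lemma ex_min_pos_upb_sum:
  obtains e where "e > 0" "min_pos 2 (add_unit (- e) upb_sum)"
proof -
  obtain e where gap: "e > 0" "\<And>z w p q. cmod z = 1 \<Longrightarrow> cmod w = 1 \<Longrightarrow>
      e * ((cmod p)\<^sup>2 + (cmod q)\<^sup>2) \<le> upb_gap z w p q"
    using upb_gap_lower_bound by blast
  have "min_pos 2 (add_unit (- e) upb_sum)"
    unfolding min_pos_iff_torus_eval psd_def torus_eval_add_unit_form
  proof (intro allI impI)
    fix z w :: complex and v :: "nat \<Rightarrow> complex"
    assume zw: "cmod z = 1" "cmod w = 1"
    show "0 \<le> (\<Sum>i<2. \<Sum>j<2. cnj (v i) * torus_eval upb_sum z w i j * v j)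
        + complex_of_real (- e * (\<Sum>i<2. (cmod (v i))\<^sup>2))"
      unfolding torus_eval_upb_sum_form[OF zw] using gap(2)[OF zw, of "v 0" "v 1"]
      by (simp add: numeral_2_eq_2 less_eq_complex_def)
  qed
  then show thesis using gap(1) that by blast
qed

lemma not_max_pos_upb_sum:
  assumes "e > 0"
  shows "\<not> max_pos 2 (add_unit (- e) upb_sum)"
proof
  assume "max_pos 2 (add_unit (- e) upb_sum)"
  then have "max_D 2 (add_unit (e / 2) (add_unit (- e) upb_sum))"
    using assms by (simp add: max_pos_iff_add_unit)
  with psd_on_upb_complement
  have "0 \<le> pairing 2 upb_complement (add_unit (e / 2) (add_unit (- e) upb_sum))"
    by (rule pairing_nonneg_of_max_D)
  then show False
    using assms
    by (simp add: pairing_upb_complement_add_unit pairing_upb_complement_upb_sum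
        less_eq_complex_def)
qed

theorem theorem3p7:
  shows "(\<forall>X. min_pos 1 X \<longrightarrow> max_pos 1 X)
     \<and> (\<exists>X. min_pos 2 X \<and> \<not> max_pos 2 X)
     \<and> (\<forall>n X. comm_pos TYPE('i) n X \<longleftrightarrow> min_pos n X)
     \<and> (\<exists>n X. min_pos n X \<and> \<not> max_pos n X)"
proof -
  obtain e where "min_pos 2 (add_unit (- e) upb_sum)" "\<not> max_pos 2 (add_unit (- e) upb_sum)"
    using ex_min_pos_upb_sum not_max_pos_upb_sum by metis
  then show ?thesis
    using min_pos_1_imp_max_pos min_pos_imp_comm_pos comm_pos_imp_min_pos by blast
qed

end
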